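(* Let $S$ be a finite set with $|S|\ge2$ and let $q$ be the rates of a continuous time Markov chain on $S$. Let $\mu^\eta_t$ be the law at time $t$ of the noisy voter model with voting mechanism $(S,q)$ started from $\eta$, and $\mu_\infty$ its stationary distribution. (i) Let $\mathbf 1$ denote the configuration of all 1's, let $\alpha\ge1$, and assume that $t:=\frac12\log|S|-\alpha\ge1$. Then $$\|\mu^{\mathbf 1}_t-\mu_\infty\|_{\mathtt{TV}}\ge\frac{0.7\,e^{2\alpha}}{16(1+q_{\max})^2\rho^2(q)+0.7\,e^{2\alpha}}.$$ (ii) Let $\mu^{\eta,H}_t$ denote the law at time $t$, started from $\eta$, of the noisy voter model on $\{0,1\}^S$ with $q\equiv0$ (i.e. the continuous time random walk on the hypercube $\{0,1\}^S$ in which each coordinate is independently rerandomized at rate 1). Then for all $t\ge0$, $$\max_{\eta_1,\eta_2\in\{0,1\}^S}\|\mu^{\eta_1}_t-\mu^{\eta_2}_t\|_{\mathtt{TV}}\le\max_{\eta_1,\eta_2\in\{0,1\}^S}\|\mu^{\eta_1,H}_t-\mu^{\eta_2,H}_t\|_{\mathtt{TV}}.$$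
   Context: A continuous time Markov chain on $S$ is given by rates $q(x,y)\ge0$ for going from $x$ to $y$ ($x\neq y$); it need not be irreducible. Set $q_{\max}:=\max\{\sum_{y\ne x}q(x,y):x\in S\}$. For a probability measure $\pi$ on $S$, let $\pi_{\mathtt{max}}:=\max_{x\in S}\pi(x)$, $\pi_{\mathtt{min}}:=\min_{x\in S}\pi(x)$ and $\rho(\pi):=\pi_{\mathtt{max}}/\pi_{\mathtt{min}}$ (equal to $\infty$ if $\pi_{\mathtt{min}}=0$). Let $\mathcal D(q)$ denote the collection of stationary distributions of the chain $(S,q)$, and $\rho(q):=\min_{\pi\in\mathcal D(q)}\rho(\pi)$. If $\rho(q)=\infty$, the right-hand side of the bound in (i) is interpreted as $0$. The noisy voter model with voting mechanism $(S,q)$ is the continuous time Markov chain $\{\eta_t\}_{t\ge0}$ on $\{0,1\}^S$ in which, independently, (1) for each two sites $x\ne y$, the state at $x$ changes to the value of the state at $y$ at rate $q(x,y)$, and (2) each site rerandomizes its state at rate 1 (its state is replaced by 0 or 1 with probability $1/2$ each, independently of everything else). Equivalently, when the configuration is $\eta$, independently at each $x\in S$, the state at $x$ changes $0\to1$ at rate $\frac12+\sum_{y\ne x}q(x,y)\eta(y)$ if $\eta(x)=0$, and $1\to0$ at rate $\frac12+\sum_{y\ne x}q(x,y)(1-\eta(y))$ if $\eta(x)=1$. This chain is irreducible and has a unique stationary distribution $\mu_\infty$; $\mu^\eta_t$ denotes the law of $\eta_t$ when $\eta_0=\eta$. Total variation distance: $\|m_1-m_2\|_{\mathtt{TV}}:=\frac12\sum_{s}|m_1(s)-m_2(s)|$.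 *)

theory Defs
  imports "HOL-Analysis.Analysis"
begin

text \<open>A continuous time Markov chain on a finite type is given by its off-diagonal jump rates;
  the values \<open>r x x\<close> are never used.\<close>

definition generator :: "('s::finite \<Rightarrow> 's \<Rightarrow> real) \<Rightarrow> real ^ 's ^ 's" where
  "generator r = (\<chi> x y. if x = y then - (\<Sum>z\<in>UNIV - {x}. r x z) else r x y)"

text \<open>\<open>transition r t x y\<close> is the \<open>(x, y)\<close> entry of \<open>exp (t G)\<close> for the generator \<open>G\<close>, that is, the
  probability that the chain started at \<open>x\<close> is at \<open>y\<close> at time \<open>t\<close>. The matrix power is an iterated
  product because \<open>*\<close> and \<open>^\<close> on \<open>real ^ 's ^ 's\<close> act entrywise.\<close>

definition transition :: "('s::finite \<Rightarrow> 's \<Rightarrow> real) \<Rightarrow> real \<Rightarrow> 's \<Rightarrow> 's \<Rightarrow> real" where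
  "transition r t x y = (\<Sum>n. t ^ n / fact n * ((((**) (generator r)) ^^ n) (mat 1)) $ x $ y)"

definition stationary_distributions :: "('s::finite \<Rightarrow> 's \<Rightarrow> real) \<Rightarrow> ('s \<Rightarrow> real) set" where
  "stationary_distributions r =
     {\<pi>. (\<forall>x. 0 \<le> \<pi> x) \<and> (\<Sum>x\<in>UNIV. \<pi> x) = 1 \<and>
         (\<forall>t\<ge>0. \<forall>y. (\<Sum>x\<in>UNIV. \<pi> x * transition r t x y) = \<pi> y)}"

definition total_variation :: "('s::finite \<Rightarrow> real) \<Rightarrow> ('s \<Rightarrow> real) \<Rightarrow> real" where
  "total_variation m1 m2 = 1 / 2 * (\<Sum>s\<in>UNIV. \<bar>m1 s - m2 s\<bar>)"

definition q_max :: "('a::finite \<Rightarrow> 'a \<Rightarrow> real) \<Rightarrow> real" where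
  "q_max q = (MAX x\<in>UNIV. \<Sum>y\<in>UNIV - {x}. q x y)"

definition rho_dist :: "('a::finite \<Rightarrow> real) \<Rightarrow> ereal" where
  "rho_dist \<pi> = (if (MIN x\<in>UNIV. \<pi> x) = 0 then \<infinity>
                 else ereal ((MAX x\<in>UNIV. \<pi> x) / (MIN x\<in>UNIV. \<pi> x)))"

text \<open>The infimum is attained: the stationary distributions form a nonempty compact set, on which
  \<open>rho_dist\<close> is lower semicontinuous. So this is the minimum.\<close>

definition rho :: "('a::finite \<Rightarrow> 'a \<Rightarrow> real) \<Rightarrow> ereal" where
  "rho q = (INF \<pi>\<in>stationary_distributions q. rho_dist \<pi>)"

text \<open>Configurations are functions \<open>'a \<Rightarrow> bool\<close>, with \<open>True\<close> for 1 and \<open>False\<close> for 0. The rate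
  \<open>1 / 2\<close> comes from a rerandomization, which changes the state with probability \<open>1 / 2\<close>.\<close>

definition flip_rate :: "('a::finite \<Rightarrow> 'a \<Rightarrow> real) \<Rightarrow> ('a \<Rightarrow> bool) \<Rightarrow> 'a \<Rightarrow> real" where
  "flip_rate q \<eta> x =
     (if \<eta> x then 1 / 2 + (\<Sum>y\<in>UNIV - {x}. q x y * (1 - of_bool (\<eta> y)))
      else 1 / 2 + (\<Sum>y\<in>UNIV - {x}. q x y * of_bool (\<eta> y)))"

text \<open>For given \<open>\<eta>\<close> and \<open>\<zeta>\<close> the sum has one term if \<open>\<zeta>\<close> differs from \<open>\<eta>\<close> at exactly one site,
  and is empty otherwise.\<close>

definition nvm_rate ::
    "('a::finite \<Rightarrow> 'a \<Rightarrow> real) \<Rightarrow> ('a \<Rightarrow> bool) \<Rightarrow> ('a \<Rightarrow> bool) \<Rightarrow> real" where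
  "nvm_rate q \<eta> \<zeta> = (\<Sum>x | \<zeta> = \<eta>(x := \<not> \<eta> x). flip_rate q \<eta> x)"

definition nvm_law ::
    "('a::finite \<Rightarrow> 'a \<Rightarrow> real) \<Rightarrow> ('a \<Rightarrow> bool) \<Rightarrow> real \<Rightarrow> ('a \<Rightarrow> bool) \<Rightarrow> real" where
  "nvm_law q \<eta> t = transition (nvm_rate q) t \<eta>"

text \<open>For nonnegative \<open>q\<close> the chain is irreducible, since every flip rate is at least \<open>1 / 2\<close>, so it
  has exactly one stationary distribution.\<close>

definition nvm_stationary :: "('a::finite \<Rightarrow> 'a \<Rightarrow> real) \<Rightarrow> ('a \<Rightarrow> bool) \<Rightarrow> real" where
  "nvm_stationary q = (THE \<mu>. \<mu> \<in> stationary_distributions (nvm_rate q))"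

end

theory Submission imports Defs begin

text \<open>
  A matrix indexed by a finite state space is treated as an element of the Banach algebra of kernels,
  so that the transition function of a chain with generator \<open>G\<close> is the exponential \<open>exp (t G)\<close>.

  Lower bound. Let \<open>\<pi>\<close> be stationary for the voting mechanism and let \<open>W\<close> be the sum of the spins
  \<open>\<plusminus>1\<close> with weights \<open>\<pi>\<close>. Voting preserves \<open>W\<close> on average because \<open>\<pi>\<close> is stationary, and
  rerandomization pulls every spin to 0 at rate 1, so \<open>W\<close> is an eigenfunction of the generator with
  eigenvalue \<open>-1\<close>. Hence its mean is \<open>exp (- t)\<close> at time \<open>t\<close> when the start is all ones, and 0 in
  equilibrium. A flip at \<open>x\<close> changes \<open>W\<close> by \<open>2 \<pi> x\<close> and has rate at most \<open>1 / 2 + q_max q\<close>; this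
  bounds the variance of \<open>W\<close>, at time \<open>t\<close> and in equilibrium, by \<open>V = (1 + 2 q_max q) \<Sum>\<pi>\<^sup>2\<close>
  (\<open>second_moment_bound\<close>, \<open>stationary_moments\<close>), which is of order \<open>1 / |S|\<close>. Two laws whose means
  differ by \<open>a\<close> while their variances are at most \<open>V\<close> are at distance at least \<open>a\<^sup>2 / (a\<^sup>2 + 4 V)\<close>
  (\<open>total_variation_lower_bound\<close>), and at time \<open>ln |S| / 2 - \<alpha>\<close> the squared mean is
  \<open>exp (2 \<alpha>) / |S|\<close>.

  Upper bound. Trace the opinion of a site back in time: it is the opinion of an ancestor at time 0,
  seen through the noise that accumulated along the ancestral line. If there is no voting, the lines
  are separate and the noise is independent, which gives the hypercube walk. Voting makes ancestral
  lines coalesce, so that sites share part of their noise. Shared noise is less informative than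
  independent noise: it can be simulated from independent noise of the same strength by a random
  map that does not look at the initial configuration. This is the statement of Evans, Kenyon, Peres
  and Schulman that a broadcasting tree is dominated by the tree whose paths are cut apart. The case
  needed here is \<open>noise_copy_noise_factors\<close>. Writing the noisy voter semigroup as a limit of products
  of small voting steps and small noise steps, it follows that the law at time \<open>t\<close> is a limit of
  mixtures of garblings of hypercube laws at the same time \<open>t\<close>, started from configurations obtained
  from \<open>\<eta>\<close> by copying opinions, with weights and garblings that do not depend on \<open>\<eta>\<close>. Garbling and mixing do not increase the total variation distance.
\<close>

section \<open>The Banach algebra of kernels\<close>

text \<open>Multiplication on \<open>real ^ 's ^ 's\<close> is entrywise, so a separate type carries the matrix product. The
  norm below is the maximal absolute row sum; it is submultiplicative, and stochastic kernels have
  norm 1.\<close>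

typedef 's kernel = "UNIV :: ('s \<Rightarrow> 's \<Rightarrow> real) set"
  morphisms entry Kernel by simp

setup_lifting type_definition_kernel

lemma entry_Kernel [simp]: "entry (Kernel k) = k"
  by (simp add: Kernel_inverse)

lemma kernel_eqI: "(\<And>x y. entry A x y = entry B x y) \<Longrightarrow> A = B"
  by (metis entry_inject ext)

instantiation kernel :: (finite) "{real_vector, ring_1}"
begin

lift_definition zero_kernel :: "'a kernel" is "\<lambda>_ _. 0" .
lift_definition one_kernel :: "'a kernel" is "\<lambda>x y. of_bool (x = y)" .
lift_definition plus_kernel :: "'a kernel \<Rightarrow> 'a kernel \<Rightarrow> 'a kernel" is "\<lambda>A B x y. A x y + B x y" .
lift_definition minus_kernel :: "'a kernel \<Rightarrow> 'a kernel \<Rightarrow> 'a kernel" is "\<lambda>A B x y. A x y - B x y" .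
lift_definition uminus_kernel :: "'a kernel \<Rightarrow> 'a kernel" is "\<lambda>A x y. - A x y" .
lift_definition scaleR_kernel :: "real \<Rightarrow> 'a kernel \<Rightarrow> 'a kernel" is "\<lambda>c A x y. c * A x y" .
lift_definition times_kernel :: "'a kernel \<Rightarrow> 'a kernel \<Rightarrow> 'a kernel"
  is "\<lambda>A B x y. \<Sum>z\<in>UNIV. A x z * B z y" .

instance
proof
  fix A B C :: "'a kernel"
  show "A * B * C = A * (B * C)"
  proof transfer
    fix A B C :: "'a \<Rightarrow> 'a \<Rightarrow> real"
    show "(\<lambda>x y. \<Sum>z\<in>UNIV. (\<Sum>w\<in>UNIV. A x w * B w z) * C z y)
        = (\<lambda>x y. \<Sum>z\<in>UNIV. A x z * (\<Sum>w\<in>UNIV. B z w * C w y))"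
      unfolding sum_distrib_left sum_distrib_right
      by (intro ext, subst sum.swap) (simp add: mult.assoc)
  qed
qed (transfer; auto simp: fun_eq_iff algebra_simps sum.distrib of_bool_def if_distrib if_distribR
       cong: if_cong)+

end

lemma entry_zero [simp]: "entry 0 x y = 0" by transfer simp
lemma entry_one: "entry 1 x y = of_bool (x = y)" by transfer simp
lemma entry_add [simp]: "entry (A + B) x y = entry A x y + entry B x y" by transfer simp
lemma entry_diff [simp]: "entry (A - B) x y = entry A x y - entry B x y" by transfer simp
lemma entry_scaleR [simp]: "entry (c *\<^sub>R A) x y = c * entry A x y" by transfer simp
lemma entry_mult: "entry (A * B) x y = (\<Sum>z\<in>UNIV. entry A x z * entry B z y)" by transfer simp

lemma entry_sum: "entry (sum A I) x y = (\<Sum>i\<in>I. entry (A i) x y)"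
  by (induction I rule: infinite_finite_induct) auto

instantiation kernel :: (finite) real_normed_algebra_1
begin

definition norm_kernel :: "'a kernel \<Rightarrow> real" where
  "norm A = (MAX x\<in>UNIV. \<Sum>y\<in>UNIV. \<bar>entry A x y\<bar>)"

definition dist_kernel :: "'a kernel \<Rightarrow> 'a kernel \<Rightarrow> real" where
  "dist_kernel A B = norm (A - B)"

definition sgn_kernel :: "'a kernel \<Rightarrow> 'a kernel" where
  "sgn_kernel A = A /\<^sub>R norm A"

definition uniformity_kernel :: "('a kernel \<times> 'a kernel) filter" where
  "uniformity_kernel = (INF e\<in>{0 <..}. principal {(A :: 'a kernel, B). dist A B < e})"

definition open_kernel :: "'a kernel set \<Rightarrow> bool" where
  "open_kernel U \<longleftrightarrow> (\<forall>A\<in>U. \<forall>\<^sub>F (A', B) in uniformity. A' = A \<longrightarrow> B \<in> U)"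

lemma row_le_norm: "(\<Sum>y\<in>UNIV. \<bar>entry A x y\<bar>) \<le> norm A" for A :: "'a kernel"
  unfolding norm_kernel_def by (rule Max_ge) auto

lemma norm_le_rowsI: "(\<And>x. (\<Sum>y\<in>UNIV. \<bar>entry A x y\<bar>) \<le> b) \<Longrightarrow> norm A \<le> b" for A :: "'a kernel"
  unfolding norm_kernel_def by (rule Max.boundedI) auto

lemma abs_entry_le_norm: "\<bar>entry A x y\<bar> \<le> norm A" for A :: "'a kernel"
  using member_le_sum[of y UNIV "\<lambda>y. \<bar>entry A x y\<bar>"] row_le_norm[of A x] by simp

lemma norm_kernel_nonneg: "0 \<le> norm A" for A :: "'a kernel"
  by (rule order_trans[OF abs_ge_zero abs_entry_le_norm])

instance
proof
  fix A B :: "'a kernel" and c :: real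
  show "norm A = 0 \<longleftrightarrow> A = 0"
  proof
    assume "norm A = 0"
    then have "entry A x y = 0" for x y
      using abs_entry_le_norm[of A x y] by simp
    then show "A = 0" by (intro kernel_eqI) simp
  qed (simp add: norm_kernel_def)
  show "norm (A + B) \<le> norm A + norm B"
  proof (rule norm_le_rowsI)
    fix x
    have "(\<Sum>y\<in>UNIV. \<bar>entry (A + B) x y\<bar>) \<le> (\<Sum>y\<in>UNIV. \<bar>entry A x y\<bar>) + (\<Sum>y\<in>UNIV. \<bar>entry B x y\<bar>)"
      unfolding sum.distrib[symmetric] by (intro sum_mono) (simp add: abs_triangle_ineq)
    also have "\<dots> \<le> norm A + norm B"
      by (intro add_mono row_le_norm)
    finally show "(\<Sum>y\<in>UNIV. \<bar>entry (A + B) x y\<bar>) \<le> norm A + norm B" .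
  qed
  have scale: "norm (c *\<^sub>R A) \<le> \<bar>c\<bar> * norm A" for c and A :: "'a kernel"
    by (intro norm_le_rowsI)
      (simp add: abs_mult sum_distrib_left[symmetric] mult_left_mono row_le_norm)
  show "norm (c *\<^sub>R A) = \<bar>c\<bar> * norm A"
  proof (cases "c = 0")
    case True
    have "norm (0 :: 'a kernel) = 0" by (simp add: norm_kernel_def)
    with True show ?thesis by simp
  next
    case False
    then have "norm A = norm (inverse c *\<^sub>R c *\<^sub>R A)" by simp
    also have "\<dots> \<le> \<bar>inverse c\<bar> * norm (c *\<^sub>R A)" by (rule scale)
    finally have "\<bar>c\<bar> * norm A \<le> norm (c *\<^sub>R A)"
      using False by (simp add: field_simps)
    with scale[of c A] show ?thesis by simp
  qed
  show "norm (A * B) \<le> norm A * norm B"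
  proof (rule norm_le_rowsI)
    fix x
    have "(\<Sum>y\<in>UNIV. \<bar>entry (A * B) x y\<bar>)
        \<le> (\<Sum>y\<in>UNIV. \<Sum>z\<in>UNIV. \<bar>entry A x z\<bar> * \<bar>entry B z y\<bar>)"
      unfolding entry_mult by (intro sum_mono order_trans[OF sum_abs]) (simp add: abs_mult)
    also have "\<dots> = (\<Sum>z\<in>UNIV. \<bar>entry A x z\<bar> * (\<Sum>y\<in>UNIV. \<bar>entry B z y\<bar>))"
      by (subst sum.swap) (simp add: sum_distrib_left)
    also have "\<dots> \<le> (\<Sum>z\<in>UNIV. \<bar>entry A x z\<bar> * norm B)"
      by (intro sum_mono mult_left_mono row_le_norm) simp
    also have "\<dots> \<le> norm A * norm B"
      unfolding sum_distrib_right[symmetric]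
      by (intro mult_right_mono row_le_norm norm_kernel_nonneg)
    finally show "(\<Sum>y\<in>UNIV. \<bar>entry (A * B) x y\<bar>) \<le> norm A * norm B" .
  qed
  show "norm (1 :: 'a kernel) = 1"
    by (simp add: norm_kernel_def entry_one)
  show "a *\<^sub>R A * B = a *\<^sub>R (A * B)" "A * a *\<^sub>R B = a *\<^sub>R (A * B)" for a
    by (intro kernel_eqI; simp add: entry_mult sum_distrib_left mult_ac)+
qed (simp_all add: dist_kernel_def sgn_kernel_def uniformity_kernel_def open_kernel_def)

end

lemma bounded_linear_entry: "bounded_linear (\<lambda>A. entry A x y)"
  by (rule bounded_linear_intro[where K = 1]) (simp_all add: abs_entry_le_norm)

lemmas tendsto_entry = bounded_linear.tendsto[OF bounded_linear_entry]

lemma kernel_eq_sum_units: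
  "A = (\<Sum>x\<in>UNIV. \<Sum>y\<in>UNIV. entry A x y *\<^sub>R Kernel (\<lambda>x' y'. of_bool (x' = x \<and> y' = y)))"
proof (rule kernel_eqI)
  fix x' y'
  show "entry A x' y' = entry (\<Sum>x\<in>UNIV. \<Sum>y\<in>UNIV. entry A x y *\<^sub>R
      Kernel (\<lambda>x' y'. of_bool (x' = x \<and> y' = y))) x' y'"
    by (simp add: entry_sum of_bool_conj sum_distrib_left[symmetric] mult.assoc[symmetric]
        sum_distrib_right[symmetric] flip: mult.assoc)
qed

lemma tendsto_kernelI:
  assumes "\<And>x y. ((\<lambda>n. entry (A n) x y) \<longlongrightarrow> entry L x y) F"
  shows "(A \<longlongrightarrow> L) F"
proof -
  have "((\<lambda>n. \<Sum>x\<in>UNIV. \<Sum>y\<in>UNIV. entry (A n) x y *\<^sub>R Kernel (\<lambda>x' y'. of_bool (x' = x \<and> y' = y)))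
      \<longlongrightarrow> (\<Sum>x\<in>UNIV. \<Sum>y\<in>UNIV. entry L x y *\<^sub>R Kernel (\<lambda>x' y'. of_bool (x' = x \<and> y' = y)))) F"
    by (intro tendsto_sum tendsto_scaleR assms tendsto_const)
  then show ?thesis by (simp flip: kernel_eq_sum_units)
qed

lemma has_vector_derivative_kernelI:
  assumes "\<And>x y. ((\<lambda>s. entry (F s) x y) has_real_derivative entry G x y) (at s within S)"
  shows "(F has_vector_derivative G) (at s within S)"
proof -
  have "((\<lambda>s. \<Sum>x\<in>UNIV. \<Sum>y\<in>UNIV. entry (F s) x y *\<^sub>R Kernel (\<lambda>x' y'. of_bool (x' = x \<and> y' = y)))
      has_vector_derivative (\<Sum>x\<in>UNIV. \<Sum>y\<in>UNIV. entry G x y *\<^sub>R Kernel (\<lambda>x' y'. of_bool (x' = x \<and> y' = y))))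
      (at s within S)"
    using assms by (intro has_vector_derivative_sum) (auto intro!: derivative_eq_intros)
  then show ?thesis by (simp flip: kernel_eq_sum_units)
qed

instance kernel :: (finite) banach
proof
  fix X :: "nat \<Rightarrow> 'a kernel"
  assume "Cauchy X"
  define L where "L = Kernel (\<lambda>x y. lim (\<lambda>n. entry (X n) x y))"
  have "X \<longlonglongrightarrow> L"
  proof (rule tendsto_kernelI)
    fix x y
    have "Cauchy (\<lambda>n. entry (X n) x y)"
      by (rule bounded_linear.Cauchy[OF bounded_linear_entry \<open>Cauchy X\<close>])
    then show "(\<lambda>n. entry (X n) x y) \<longlonglongrightarrow> entry L x y"
      unfolding L_def by (simp add: Cauchy_convergent convergent_LIMSEQ_iff[symmetric])
  qed
  then show "convergent X" by (rule convergentI)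
qed

section \<open>Markov semigroups as exponentials\<close>

definition act :: "'s::finite kernel \<Rightarrow> ('s \<Rightarrow> real) \<Rightarrow> 's \<Rightarrow> real" where
  "act A f x = (\<Sum>y\<in>UNIV. entry A x y * f y)"

lemma act_mult: "act (A * B) f = act A (act B f)"
  unfolding act_def entry_mult sum_distrib_left sum_distrib_right
  by (rule ext, subst sum.swap) (simp add: mult.assoc)

lemma act_one [simp]: "act 1 f = f"
  by (rule ext) (simp add: act_def entry_one of_bool_def if_distrib if_distribR cong: if_cong)

lemma act_zero [simp]: "act A (\<lambda>_. 0) x = 0"
  by (simp add: act_def)

lemma act_add: "act (A + B) f x = act A f x + act B f x"
  by (simp add: act_def algebra_simps sum.distrib)

lemma act_scaleR: "act (c *\<^sub>R A) f x = c * act A f x"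
  by (simp add: act_def sum_distrib_left mult.assoc)

lemma act_sum: "act (sum A I) f x = (\<Sum>i\<in>I. act (A i) f x)"
  by (induction I rule: infinite_finite_induct) (simp_all add: act_add, simp_all add: act_def)

lemma act_diff: "act (A - B) f x = act A f x - act B f x"
  by (simp add: act_def algebra_simps sum_subtractf)

lemma act_fun_add: "act A (\<lambda>y. f y + g y) x = act A f x + act A g x"
  by (simp add: act_def algebra_simps sum.distrib)

lemma act_fun_cmult: "act A (\<lambda>y. c * f y) x = c * act A f x"
  by (simp add: act_def sum_distrib_left mult_ac)

lemma kernel_eq_actI:
  assumes "\<And>f. act A f = act B f" shows "A = B"
proof (rule kernel_eqI)
  fix x y
  have "act C (\<lambda>z. of_bool (z = y)) x = entry C x y" for C :: "'a kernel"
    by (simp add: act_def of_bool_def if_distrib cong: if_cong)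
  with assms show "entry A x y = entry B x y" by metis
qed

lemma bounded_linear_act: "bounded_linear (\<lambda>A. act A f x)"
  unfolding act_def
  by (intro bounded_linear_sum bounded_linear_mult_left bounded_linear_compose[OF bounded_linear_mult_left]
      bounded_linear_entry)

lemma act_exp_derivative:
  "((\<lambda>t. act (exp (t *\<^sub>R A)) f x) has_real_derivative act (exp (t *\<^sub>R A)) (act A f) x) (at t)"
proof -
  have "((\<lambda>t. act (exp (t *\<^sub>R A)) f x) has_vector_derivative act (exp (t *\<^sub>R A) * A) f x) (at t)"
    by (rule bounded_linear.has_vector_derivative[OF bounded_linear_act
          exp_scaleR_has_vector_derivative_right])
  then show ?thesis by (simp add: has_real_derivative_iff_has_vector_derivative act_mult)
qed

text \<open>Gronwall's inequality for a positive semigroup: \<open>exp (- c s) * act (exp (s A)) f\<close> has derivative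
  \<open>exp (- c s) * act (exp (s A)) (act A f - c f) \<ge> 0\<close>.\<close>

lemma act_exp_mono:
  fixes A :: "'s::finite kernel"
  assumes nonneg: "\<And>t x y. 0 \<le> t \<Longrightarrow> 0 \<le> entry (exp (t *\<^sub>R A)) x y"
    and sub: "\<And>x. c * f x \<le> act A f x" and t: "0 \<le> t"
  shows "exp (c * t) * f x \<le> act (exp (t *\<^sub>R A)) f x"
proof -
  let ?h = "\<lambda>s. exp (- c * s) * act (exp (s *\<^sub>R A)) f x"
  have "(?h has_real_derivative
      exp (- c * s) * act (exp (s *\<^sub>R A)) (\<lambda>y. act A f y + (- c) * f y) x) (at s)" for s
    unfolding act_fun_add act_fun_cmult
    by (auto intro!: derivative_eq_intros act_exp_derivative simp: algebra_simps)
  moreover have "0 \<le> exp (- c * s) * act (exp (s *\<^sub>R A)) (\<lambda>y. act A f y + (- c) * f y) x" if "0 \<le> s" for s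
    using nonneg[OF that] sub unfolding act_def[of "exp _"]
    by (intro mult_nonneg_nonneg sum_nonneg) (auto simp: act_def)
  ultimately have "?h 0 \<le> ?h t"
    using t by (intro DERIV_nonneg_imp_nondecreasing[of 0 t ?h]) blast+
  then have "exp (c * t) * f x \<le> exp (c * t) * (exp (- c * t) * act (exp (t *\<^sub>R A)) f x)"
    by (intro mult_left_mono) auto
  then show ?thesis
    by (simp add: mult.assoc[symmetric] exp_add[symmetric])
qed

lemma act_exp_eigen:
  assumes eigen: "\<And>x. act A f x = c * f x"
  shows "act (exp (t *\<^sub>R A)) f x = exp (c * t) * f x"
proof -
  let ?h = "\<lambda>s. exp (- c * s) * act (exp (s *\<^sub>R A)) f x"
  have "(?h has_real_derivative
      exp (- c * s) * act (exp (s *\<^sub>R A)) (\<lambda>y. act A f y + (- c) * f y) x) (at s)" for s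
    unfolding act_fun_add act_fun_cmult
    by (auto intro!: derivative_eq_intros act_exp_derivative simp: algebra_simps)
  then have "(?h has_real_derivative 0) (at s)" for s
    by (simp add: eigen)
  then have "?h t = ?h 0"
    using DERIV_isconst_all[of ?h t 0] by blast
  then have "exp (c * t) * ?h t = exp (c * t) * f x"
    by simp
  then show ?thesis
    by (simp add: mult.assoc[symmetric] exp_add[symmetric])
qed

text \<open>Row vectors that the generator annihilates are invariant under the semigroup, because \<open>exp (s A)\<close>
  has derivative \<open>A * exp (s A)\<close>.\<close>

lemma left_null_exp:
  assumes null: "\<And>y. (\<Sum>x\<in>UNIV. v x * entry A x y) = 0"
  shows "(\<Sum>x\<in>UNIV. v x * entry (exp (t *\<^sub>R A)) x y) = v y"
proof -
  let ?h = "\<lambda>M. \<Sum>x\<in>UNIV. v x * entry M x y"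
  have bl: "bounded_linear ?h"
    by (intro bounded_linear_sum bounded_linear_compose[OF bounded_linear_mult_right] bounded_linear_entry)
  have "((\<lambda>s. ?h (exp (s *\<^sub>R A))) has_vector_derivative ?h (A * exp (s *\<^sub>R A))) (at s)" for s
    by (rule bounded_linear.has_vector_derivative[OF bl exp_scaleR_has_vector_derivative_left])
  moreover have "?h (A * M) = 0" for M
  proof -
    have "?h (A * M) = (\<Sum>z\<in>UNIV. (\<Sum>x\<in>UNIV. v x * entry A x z) * entry M z y)"
      unfolding entry_mult sum_distrib_left sum_distrib_right
      by (subst sum.swap) (simp add: mult.assoc)
    then show ?thesis by (simp add: null)
  qed
  ultimately have "((\<lambda>s. ?h (exp (s *\<^sub>R A))) has_real_derivative 0) (at s)" for s
    by (simp add: has_real_derivative_iff_has_vector_derivative)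
  then have "?h (exp (t *\<^sub>R A)) = ?h (exp (0 *\<^sub>R A))"
    using DERIV_isconst_all[of "\<lambda>s. ?h (exp (s *\<^sub>R A))" t 0] by blast
  then show ?thesis
    by (simp add: entry_one of_bool_def if_distrib cong: if_cong)
qed

definition gen :: "('s::finite \<Rightarrow> 's \<Rightarrow> real) \<Rightarrow> 's kernel" where
  "gen r = Kernel (\<lambda>x y. generator r $ x $ y)"

lemma transition_eq_exp: "transition r t x y = entry (exp (t *\<^sub>R gen r)) x y"
proof -
  have pow: "(((**) (generator r)) ^^ n) (mat 1) $ x $ y = entry (gen r ^ n) x y" for n x y
    by (induction n arbitrary: x y)
      (simp_all add: mat_def entry_one matrix_matrix_mult_def entry_mult gen_def)
  have "entry (exp (t *\<^sub>R gen r)) x y = (\<Sum>n. entry ((t *\<^sub>R gen r) ^ n /\<^sub>R fact n) x y)"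
    unfolding exp_def by (rule bounded_linear.suminf[OF bounded_linear_entry summable_exp_generic])
  also have "\<dots> = transition r t x y"
    unfolding transition_def pow by (simp add: scaleR_power divide_inverse mult_ac)
  finally show ?thesis ..
qed

lemma act_gen: "act (gen r) f x = (\<Sum>y\<in>UNIV. r x y * (f y - f x))"
proof -
  have "act (gen r) f x = - (\<Sum>z\<in>UNIV - {x}. r x z) * f x + (\<Sum>y\<in>UNIV - {x}. r x y * f y)"
    unfolding act_def gen_def by (subst sum.remove[of _ x]) (auto simp: generator_def intro!: sum.cong)
  also have "\<dots> = (\<Sum>y\<in>UNIV - {x}. r x y * (f y - f x))"
    by (simp add: algebra_simps sum_subtractf sum_distrib_left)
  also have "\<dots> = (\<Sum>y\<in>UNIV. r x y * (f y - f x))"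
    by (subst (2) sum.remove[of _ x]) auto
  finally show ?thesis .
qed

definition stochastic :: "'s::finite kernel \<Rightarrow> bool" where
  "stochastic K \<longleftrightarrow> (\<forall>x y. 0 \<le> entry K x y) \<and> (\<forall>x. (\<Sum>y\<in>UNIV. entry K x y) = 1)"

lemma stochastic_nonneg: "stochastic K \<Longrightarrow> 0 \<le> entry K x y"
  by (simp add: stochastic_def)

lemma stochastic_row_sum: "stochastic K \<Longrightarrow> (\<Sum>y\<in>UNIV. entry K x y) = 1"
  by (simp add: stochastic_def)

lemma stochastic_one: "stochastic 1"
  by (simp add: stochastic_def entry_one of_bool_def)

lemma stochastic_mult:
  assumes "stochastic A" "stochastic B" shows "stochastic (A * B)"
  unfolding stochastic_def
proof (intro conjI allI)
  fix x y
  show "0 \<le> entry (A * B) x y"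
    using assms by (simp add: entry_mult sum_nonneg stochastic_nonneg)
next
  fix x
  show "(\<Sum>y\<in>UNIV. entry (A * B) x y) = 1"
    unfolding entry_mult by (subst sum.swap) (simp add: sum_distrib_left[symmetric] stochastic_row_sum assms)
qed

lemma stochastic_norm_le: "stochastic K \<Longrightarrow> norm K \<le> 1"
  by (intro norm_le_rowsI) (simp add: stochastic_def)

lemma exp_entry_nonneg:
  assumes "\<And>x y. 0 \<le> entry B x y"
  shows "0 \<le> entry (exp B) x y"
proof -
  have pow: "0 \<le> entry (B ^ n) x y" for n x y
    by (induction n arbitrary: x y) (auto simp: entry_one entry_mult intro!: sum_nonneg assms mult_nonneg_nonneg)
  have "entry (exp B) x y = (\<Sum>n. entry (B ^ n /\<^sub>R fact n) x y)"
    unfolding exp_def by (rule bounded_linear.suminf[OF bounded_linear_entry summable_exp_generic])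
  also have "\<dots> \<ge> 0"
    by (intro suminf_nonneg bounded_linear.summable[OF bounded_linear_entry summable_exp_generic])
      (simp add: pow)
  finally show ?thesis .
qed

text \<open>Entries of \<open>gen r\<close> can be negative only on the diagonal. Adding \<open>c\<close> times the identity, with \<open>c\<close>
  at least every exit rate, makes them all nonnegative, and it changes the exponential by the
  positive factor \<open>exp (t c)\<close> only.\<close>

lemma stochastic_exp_gen:
  assumes r: "\<And>x y. x \<noteq> y \<Longrightarrow> 0 \<le> r x y" and t: "0 \<le> t"
  shows "stochastic (exp (t *\<^sub>R gen r))"
  unfolding stochastic_def
proof (intro conjI allI)
  fix x y
  define c where "c = (\<Sum>x\<in>UNIV. \<Sum>z\<in>UNIV - {x}. r x z)"
  have exit: "(\<Sum>z\<in>UNIV - {x}. r x z) \<le> c" for x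
    unfolding c_def using r by (intro member_le_sum sum_nonneg) auto
  let ?B = "t *\<^sub>R (gen r + c *\<^sub>R 1)"
  have "0 \<le> entry ?B x y" for x y
    using exit r t by (auto simp: gen_def generator_def entry_one)
  then have B: "0 \<le> entry (exp ?B) x y" for x y
    by (rule exp_entry_nonneg)
  have "t *\<^sub>R gen r = ?B + of_real (- (t * c))"
    by (simp add: of_real_def algebra_simps)
  moreover have "exp (?B + of_real (- (t * c))) = exp ?B * exp (of_real (- (t * c)))"
    by (rule exp_add_commuting) (simp add: of_real_def)
  ultimately have "exp (t *\<^sub>R gen r) = exp ?B * of_real (exp (- (t * c)))"
    by (simp only: exp_of_real)
  then have "entry (exp (t *\<^sub>R gen r)) x y = exp (- (t * c)) * entry (exp ?B) x y"
    by (simp add: of_real_def)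
  with B show "0 \<le> entry (exp (t *\<^sub>R gen r)) x y" by simp
next
  fix x
  have "act (exp (t *\<^sub>R gen r)) (\<lambda>_. 1) x = exp (0 * t) * 1"
    by (rule act_exp_eigen) (simp add: act_gen)
  then show "(\<Sum>y\<in>UNIV. entry (exp (t *\<^sub>R gen r)) x y) = 1"
    by (simp add: act_def)
qed

lemma exp_scaleR_of_nat:
  fixes A :: "'b::{real_normed_algebra_1, banach}"
  shows "exp ((real n * s) *\<^sub>R A) = exp (s *\<^sub>R A) ^ n"
proof (induction n)
  case (Suc n)
  have "exp (s *\<^sub>R A + (real n * s) *\<^sub>R A) = exp (s *\<^sub>R A) * exp ((real n * s) *\<^sub>R A)"
    by (rule exp_add_commuting) simp
  with Suc show ?case by (simp add: algebra_simps)
qed simp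

lemma norm_power_diff_le:
  fixes z w :: "'b::real_normed_algebra_1"
  assumes z: "norm z \<le> 1" and w: "norm w \<le> 1"
  shows "norm (z ^ n - w ^ n) \<le> real n * norm (z - w)"
proof (induction n)
  case (Suc n)
  have "z ^ Suc n - w ^ Suc n = z * (z ^ n - w ^ n) + (z - w) * w ^ n"
    by (simp add: algebra_simps)
  also have "norm \<dots> \<le> norm z * norm (z ^ n - w ^ n) + norm (z - w) * norm (w ^ n)"
    by (intro norm_triangle_mono norm_mult_ineq)
  also have "\<dots> \<le> 1 * (real n * norm (z - w)) + norm (z - w) * 1"
    using Suc z w norm_power_ineq[of w n] power_le_one[of "norm w" n]
    by (intro add_mono mult_mono) auto
  finally show ?case by (simp add: algebra_simps)
qed simp

lemma filterlim_over_n_at_right: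
  assumes "0 < (t :: real)" shows "filterlim (\<lambda>n. t / real n) (at_right 0) sequentially"
  unfolding filterlim_at
proof
  show "\<forall>\<^sub>F n in sequentially. t / real n \<in> {0<..} \<and> t / real n \<noteq> 0"
    using eventually_gt_at_top[of 0] by eventually_elim (use assms in simp)
qed (rule lim_const_over_n)

text \<open>Chernoff's product formula: only the derivative of \<open>F\<close> at 0 matters, because contractions satisfy
  \<open>\<parallel>z\<^sup>n - w\<^sup>n\<parallel> \<le> n \<parallel>z - w\<parallel>\<close> and \<open>n\<close> times an error \<open>o(t / n)\<close> vanishes.\<close>

lemma exp_eq_limit_of_powers:
  fixes G :: "'b::{real_normed_algebra_1, banach}"
  assumes F0: "F 0 = 1" and deriv: "(F has_vector_derivative G) (at 0 within {0..})"
    and F: "\<forall>\<^sub>F s in at_right 0. norm (F s) \<le> 1"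
    and G: "\<And>s. 0 \<le> s \<Longrightarrow> norm (exp (s *\<^sub>R G)) \<le> 1" and t: "0 < t"
  shows "(\<lambda>n. F (t / real n) ^ n) \<longlonglongrightarrow> exp (t *\<^sub>R G)"
proof (rule Lim_transform)
  let ?D = "\<lambda>s. F s - exp (s *\<^sub>R G)"
  have "((\<lambda>s. exp (s *\<^sub>R G)) has_vector_derivative G) (at 0 within {0..})"
    using exp_scaleR_has_vector_derivative_left[of G 0] has_vector_derivative_at_within by fastforce
  from has_vector_derivative_diff[OF deriv this]
  have "(?D has_vector_derivative 0) (at 0 within {0..})" by simp
  then have "((\<lambda>s. (1 / norm (s - 0)) *\<^sub>R ?D s) \<longlongrightarrow> 0) (at 0 within {0..})"
    unfolding has_vector_derivative_def has_derivative_within by (simp add: F0)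
  then have "((\<lambda>s. (1 / norm (s - 0)) *\<^sub>R ?D s) \<longlongrightarrow> 0) (at_right 0)"
    by (rule tendsto_mono[rotated]) (auto intro: at_le)
  then have "((\<lambda>s. norm ((1 / norm (s - 0)) *\<^sub>R ?D s)) \<longlongrightarrow> 0) (at_right 0)"
    by (rule tendsto_norm_zero)
  moreover have "\<forall>\<^sub>F s in at_right 0. norm ((1 / norm (s - 0)) *\<^sub>R ?D s) = norm (?D s) / s"
    by (auto simp: eventually_at_filter)
  ultimately have "((\<lambda>s. norm (?D s) / s) \<longlongrightarrow> 0) (at_right 0)"
    by (rule Lim_transform_eventually)
  moreover have lim: "filterlim (\<lambda>n. t / real n) (at_right 0) sequentially"
    using t by (rule filterlim_over_n_at_right)
  ultimately have "(\<lambda>n. norm (?D (t / real n)) / (t / real n)) \<longlonglongrightarrow> 0"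
    by (rule filterlim_compose)
  from tendsto_mult_left[OF this, of t]
  have "(\<lambda>n. real n * norm (?D (t / real n))) \<longlonglongrightarrow> 0"
    using t by (simp add: mult_ac)
  moreover have "\<forall>\<^sub>F n in sequentially. norm (F (t / real n) ^ n - exp (t *\<^sub>R G)) \<le> real n * norm (?D (t / real n))"
    using eventually_compose_filterlim[OF F lim] eventually_gt_at_top[of 0]
  proof eventually_elim
    case (elim n)
    have "exp (t *\<^sub>R G) = exp ((t / real n) *\<^sub>R G) ^ n"
      using elim by (simp flip: exp_scaleR_of_nat)
    with norm_power_diff_le[OF elim(1), of "exp ((t / real n) *\<^sub>R G)" n] t show ?case
      by (simp add: G)
  qed
  ultimately show "(\<lambda>n. F (t / real n) ^ n - exp (t *\<^sub>R G)) \<longlonglongrightarrow> 0"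
    by (rule Lim_null_comparison[rotated])
qed simp

section \<open>Stationary distributions\<close>

lemma stationary_left_null:
  assumes "\<pi> \<in> stationary_distributions r"
  shows "(\<Sum>x\<in>UNIV. \<pi> x * entry (gen r) x y) = 0"
proof -
  let ?h = "\<lambda>M. \<Sum>x\<in>UNIV. \<pi> x * entry M x y"
  have bl: "bounded_linear ?h"
    by (intro bounded_linear_sum bounded_linear_compose[OF bounded_linear_mult_right] bounded_linear_entry)
  have "((\<lambda>t. ?h (exp (t *\<^sub>R gen r))) has_vector_derivative ?h (gen r * exp (0 *\<^sub>R gen r))) (at 0 within {0..1})"
    using bounded_linear.has_vector_derivative[OF bl exp_scaleR_has_vector_derivative_left]
    by (rule has_vector_derivative_at_within)
  then have "((\<lambda>t. ?h (exp (t *\<^sub>R gen r))) has_vector_derivative ?h (gen r)) (at 0 within {0..1})"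
    by simp
  then have deriv: "((\<lambda>t. \<pi> y) has_vector_derivative ?h (gen r)) (at 0 within {0..1})"
  proof (rule has_vector_derivative_transform[rotated 2])
    show "\<pi> y = ?h (exp (t *\<^sub>R gen r))" if "t \<in> {0..1}" for t
      using assms that by (simp add: stationary_distributions_def transition_eq_exp)
  qed simp
  have "at (0::real) within {0..1} \<noteq> bot"
    by (simp add: at_within_Icc_at_right)
  then show ?thesis
    by (rule vector_derivative_unique_within[OF _ deriv has_vector_derivative_const])
qed

text \<open>The generator annihilates constants, so it is singular and has a nonzero left null vector \<open>v\<close>.
  Then \<open>\<bar>v\<bar>\<close> is invariant as well: \<open>\<bar>v\<bar> = \<bar>v P\<bar> \<le> \<bar>v\<bar> P\<close> entrywise, and both sides have the same
  total mass because \<open>P\<close> is stochastic.\<close>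

lemma stationary_distribution_exists:
  fixes r :: "'s::finite \<Rightarrow> 's \<Rightarrow> real"
  assumes r: "\<And>x y. x \<noteq> y \<Longrightarrow> 0 \<le> r x y"
  shows "stationary_distributions r \<noteq> {}"
proof -
  let ?G = "generator r"
  have entry_gen: "entry (gen r) x y = ?G $ x $ y" for x y
    by (simp add: gen_def)
  have G1: "?G *v (\<chi> x. 1) = 0"
  proof -
    have "(?G *v (\<chi> x. 1)) $ x = act (gen r) (\<lambda>_. 1) x" for x
      by (simp add: matrix_vector_mult_def act_def entry_gen)
    then show ?thesis by (simp add: vec_eq_iff act_gen)
  qed
  obtain v where v: "transpose ?G *v v = 0" "v \<noteq> 0"
  proof (rule ccontr)
    assume "\<not> thesis"
    then have "\<forall>v. transpose ?G *v v = 0 \<longrightarrow> v = 0" using that by blast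
    then obtain B where "B ** transpose ?G = mat 1"
      using matrix_left_invertible_ker[of "transpose ?G"] by blast
    then have "transpose (B ** transpose ?G) = transpose (mat 1)" by simp
    then have "?G ** transpose B = mat 1"
      by (simp add: matrix_transpose_mul transpose_mat)
    then have "transpose B ** ?G = mat 1"
      by (simp add: matrix_left_right_inverse)
    then have "(\<chi> x. 1) = (transpose B ** ?G) *v (\<chi> x. 1)" by simp
    also have "\<dots> = 0"
      by (simp add: matrix_vector_mul_assoc[symmetric] G1)
    finally show False by (simp add: vec_eq_iff)
  qed
  have null: "(\<Sum>x\<in>UNIV. v $ x * entry (gen r) x y) = 0" for y
    using v(1) by (simp add: entry_gen vec_eq_iff matrix_vector_mult_def transpose_def mult.commute)
  define Z where "Z = (\<Sum>x\<in>UNIV. \<bar>v $ x\<bar>)"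
  have Z: "0 < Z"
  proof -
    obtain x where "v $ x \<noteq> 0" using v(2) by (auto simp: vec_eq_iff)
    then show ?thesis unfolding Z_def by (intro sum_pos2[of _ x]) auto
  qed
  have inv: "(\<Sum>x\<in>UNIV. \<bar>v $ x\<bar> * entry (exp (t *\<^sub>R gen r)) x y) = \<bar>v $ y\<bar>" if "0 \<le> t" for t y
  proof -
    let ?P = "exp (t *\<^sub>R gen r)"
    let ?e = "\<lambda>y. (\<Sum>x\<in>UNIV. \<bar>v $ x\<bar> * entry ?P x y) - \<bar>v $ y\<bar>"
    have P: "stochastic ?P" by (rule stochastic_exp_gen[OF r that])
    have "0 \<le> ?e y" for y
    proof -
      have "\<bar>v $ y\<bar> = \<bar>\<Sum>x\<in>UNIV. v $ x * entry ?P x y\<bar>"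
        using left_null_exp[where v = "($) v", OF null] by simp
      also have "\<dots> \<le> (\<Sum>x\<in>UNIV. \<bar>v $ x * entry ?P x y\<bar>)" by (rule sum_abs)
      finally show ?thesis by (simp add: abs_mult stochastic_nonneg[OF P])
    qed
    moreover have "sum ?e UNIV = 0"
    proof -
      have "(\<Sum>y\<in>UNIV. \<Sum>x\<in>UNIV. \<bar>v $ x\<bar> * entry ?P x y) = Z"
        by (subst sum.swap) (simp add: Z_def stochastic_row_sum[OF P] flip: sum_distrib_left)
      then show ?thesis by (simp add: sum_subtractf Z_def)
    qed
    ultimately have "?e y = 0" by (simp add: sum_nonneg_eq_0_iff)
    then show ?thesis by simp
  qed
  have "(\<lambda>x. \<bar>v $ x\<bar> / Z) \<in> stationary_distributions r"
    using Z inv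
    by (auto simp: stationary_distributions_def transition_eq_exp sum_divide_distrib[symmetric])
      (auto simp: Z_def)
  then show ?thesis by blast
qed

section \<open>Total variation distance\<close>

lemma total_variation_nonneg: "0 \<le> total_variation m1 m2"
  by (simp add: total_variation_def sum_nonneg)

lemma total_variation_zero_imp_eq: "total_variation m1 m2 \<le> 0 \<Longrightarrow> m1 = m2"
proof
  fix s
  assume "total_variation m1 m2 \<le> 0"
  then have "(\<Sum>s\<in>UNIV. \<bar>m1 s - m2 s\<bar>) = 0"
    unfolding total_variation_def by (intro order_antisym sum_nonneg) auto
  then show "m1 s = m2 s"
    by (simp add: sum_nonneg_eq_0_iff)
qed

lemma total_variation_mult_stochastic:
  assumes K: "stochastic K"
  shows "total_variation (entry (A * K) x) (entry (A * K) y) \<le> total_variation (entry A x) (entry A y)"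
proof -
  have "(\<Sum>z\<in>UNIV. \<bar>entry (A * K) x z - entry (A * K) y z\<bar>)
      \<le> (\<Sum>z\<in>UNIV. \<Sum>w\<in>UNIV. \<bar>entry A x w - entry A y w\<bar> * entry K w z)"
    unfolding entry_mult sum_subtractf[symmetric] left_diff_distrib[symmetric]
    by (intro sum_mono order_trans[OF sum_abs]) (simp add: abs_mult stochastic_nonneg[OF K])
  also have "\<dots> = (\<Sum>w\<in>UNIV. \<bar>entry A x w - entry A y w\<bar>)"
    by (subst sum.swap) (simp add: stochastic_row_sum[OF K] flip: sum_distrib_left)
  finally show ?thesis by (simp add: total_variation_def)
qed

text \<open>Couple the two starting laws independently: the difference of the mixtures is the average of
  the differences of rows over the product of \<open>\<mu>\<close> and \<open>\<nu>\<close>.\<close>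

lemma total_variation_mixture_le:
  assumes \<mu>: "\<And>x. 0 \<le> \<mu> x" "(\<Sum>x\<in>UNIV. \<mu> x) = 1"
    and \<nu>: "\<And>x. 0 \<le> \<nu> x" "(\<Sum>x\<in>UNIV. \<nu> x) = 1"
    and d: "\<And>x y. total_variation (entry K x) (entry K y) \<le> d"
  shows "total_variation (\<lambda>z. \<Sum>x\<in>UNIV. \<mu> x * entry K x z) (\<lambda>z. \<Sum>x\<in>UNIV. \<nu> x * entry K x z) \<le> d"
proof -
  have diff: "(\<Sum>x\<in>UNIV. \<mu> x * entry K x z) - (\<Sum>y\<in>UNIV. \<nu> y * entry K y z)
      = (\<Sum>x\<in>UNIV. \<Sum>y\<in>UNIV. \<mu> x * \<nu> y * (entry K x z - entry K y z))" for z
  proof -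
    have "(\<Sum>x\<in>UNIV. \<mu> x * entry K x z) = (\<Sum>x\<in>UNIV. \<Sum>y\<in>UNIV. \<mu> x * \<nu> y * entry K x z)"
      by (simp add: \<nu> mult.assoc mult.left_commute flip: sum_distrib_right sum_distrib_left)
    moreover have "(\<Sum>y\<in>UNIV. \<nu> y * entry K y z) = (\<Sum>x\<in>UNIV. \<Sum>y\<in>UNIV. \<mu> x * \<nu> y * entry K y z)"
      by (subst sum.swap) (simp add: \<mu> mult.assoc flip: sum_distrib_right)
    ultimately show ?thesis by (simp add: right_diff_distrib sum_subtractf)
  qed
  have "(\<Sum>z\<in>UNIV. \<bar>(\<Sum>x\<in>UNIV. \<mu> x * entry K x z) - (\<Sum>y\<in>UNIV. \<nu> y * entry K y z)\<bar>)
      \<le> (\<Sum>z\<in>UNIV. \<Sum>x\<in>UNIV. \<Sum>y\<in>UNIV. \<mu> x * \<nu> y * \<bar>entry K x z - entry K y z\<bar>)"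
    unfolding diff
    by (intro sum_mono order_trans[OF sum_abs] order_refl) (simp add: abs_mult \<mu> \<nu>)
  also have "\<dots> = (\<Sum>x\<in>UNIV. \<Sum>y\<in>UNIV. \<mu> x * \<nu> y * (\<Sum>z\<in>UNIV. \<bar>entry K x z - entry K y z\<bar>))"
    by (subst sum.swap, rule sum.cong[OF refl], subst sum.swap) (simp add: sum_distrib_left)
  also have "\<dots> \<le> (\<Sum>x\<in>UNIV. \<Sum>y\<in>UNIV. \<mu> x * \<nu> y * (2 * d))"
    using d by (intro sum_mono mult_left_mono mult_nonneg_nonneg \<mu> \<nu>) (simp add: total_variation_def mult.commute)
  also have "\<dots> = 2 * d"
    by (simp add: \<mu> \<nu> flip: sum_distrib_left sum_distrib_right)
  finally show ?thesis by (simp add: total_variation_def)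
qed

lemma convex_total_variation_rows:
  "convex {M. total_variation (entry M x) (entry M y) \<le> d}"
proof (rule convexI, safe)
  fix A B :: "'a kernel" and u v :: real
  assume uv: "0 \<le> u" "0 \<le> v" "u + v = 1"
  let ?tv = "\<lambda>M. total_variation (entry M x) (entry M y)"
  assume AB: "?tv A \<le> d" "?tv B \<le> d"
  have "?tv (u *\<^sub>R A + v *\<^sub>R B) \<le> u * ?tv A + v * ?tv B"
  proof -
    have "\<bar>entry (u *\<^sub>R A + v *\<^sub>R B) x s - entry (u *\<^sub>R A + v *\<^sub>R B) y s\<bar>
        \<le> u * \<bar>entry A x s - entry A y s\<bar> + v * \<bar>entry B x s - entry B y s\<bar>" for s
    proof -
      have "entry (u *\<^sub>R A + v *\<^sub>R B) x s - entry (u *\<^sub>R A + v *\<^sub>R B) y s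
          = u * (entry A x s - entry A y s) + v * (entry B x s - entry B y s)"
        by (simp add: algebra_simps)
      then show ?thesis
        using uv abs_triangle_ineq[of "u * (entry A x s - entry A y s)" "v * (entry B x s - entry B y s)"]
        by (simp add: abs_mult)
    qed
    then have "(\<Sum>s\<in>UNIV. \<bar>entry (u *\<^sub>R A + v *\<^sub>R B) x s - entry (u *\<^sub>R A + v *\<^sub>R B) y s\<bar>)
        \<le> (\<Sum>s\<in>UNIV. u * \<bar>entry A x s - entry A y s\<bar> + v * \<bar>entry B x s - entry B y s\<bar>)"
      by (rule sum_mono)
    then show ?thesis
      by (simp add: total_variation_def sum.distrib sum_distrib_left[symmetric] algebra_simps)
  qed
  also have "\<dots> \<le> u * d + v * d"
    using AB uv by (intro add_mono mult_left_mono)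
  finally show "?tv (u *\<^sub>R A + v *\<^sub>R B) \<le> d"
    using uv by (simp flip: distrib_right)
qed

text \<open>Centre \<open>f\<close> halfway between the two means to get \<open>g\<close> and apply the Cauchy--Schwarz inequality to
  \<open>a = \<Sum>(m1 - m2) g\<close> with the weights \<open>\<bar>m1 - m2\<bar>\<close>. The sum of these weights is twice the total
  variation distance, and the second moments of \<open>g\<close> are at most \<open>V + a\<^sup>2 / 4\<close> each.\<close>

lemma total_variation_lower_bound:
  fixes f :: "'s::finite \<Rightarrow> real"
  assumes m1: "\<And>s. 0 \<le> m1 s" "(\<Sum>s\<in>UNIV. m1 s) = 1"
    and m2: "\<And>s. 0 \<le> m2 s" "(\<Sum>s\<in>UNIV. m2 s) = 1"
    and mean1: "(\<Sum>s\<in>UNIV. m1 s * f s) = a" and mean2: "(\<Sum>s\<in>UNIV. m2 s * f s) = 0"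
    and sq1: "(\<Sum>s\<in>UNIV. m1 s * (f s)\<^sup>2) \<le> a\<^sup>2 + V" and sq2: "(\<Sum>s\<in>UNIV. m2 s * (f s)\<^sup>2) \<le> V"
  shows "a\<^sup>2 \<le> total_variation m1 m2 * (a\<^sup>2 + 4 * V)"
proof -
  let ?g = "\<lambda>s. f s - a / 2" and ?D = "\<lambda>s. \<bar>m1 s - m2 s\<bar>"
  have gsq: "(\<Sum>s\<in>UNIV. m s * (?g s)\<^sup>2)
      = (\<Sum>s\<in>UNIV. m s * (f s)\<^sup>2) - a * (\<Sum>s\<in>UNIV. m s * f s) + a\<^sup>2 / 4 * (\<Sum>s\<in>UNIV. m s)"
    for m :: "'s \<Rightarrow> real"
  proof -
    have "m s * (?g s)\<^sup>2 = m s * (f s)\<^sup>2 - a * (m s * f s) + a\<^sup>2 / 4 * m s" for s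
      by (simp add: power2_eq_square algebra_simps)
    then show ?thesis
      by (simp add: sum.distrib sum_subtractf sum_distrib_left)
  qed
  have a_eq: "a = (\<Sum>s\<in>UNIV. (m1 s - m2 s) * ?g s)"
    using m1(2) m2(2) mean1 mean2
    by (simp add: algebra_simps sum.distrib sum_subtractf flip: sum_distrib_left sum_divide_distrib)
  have "a\<^sup>2 \<le> (\<Sum>s\<in>UNIV. sqrt (?D s) * (sqrt (?D s) * \<bar>?g s\<bar>))\<^sup>2"
  proof -
    have "\<bar>a\<bar> \<le> (\<Sum>s\<in>UNIV. \<bar>(m1 s - m2 s) * ?g s\<bar>)"
      by (subst a_eq) (rule sum_abs)
    also have "\<dots> = (\<Sum>s\<in>UNIV. sqrt (?D s) * (sqrt (?D s) * \<bar>?g s\<bar>))"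
      by (simp add: abs_mult flip: mult.assoc)
    finally show ?thesis by (rule abs_le_square_iff[THEN iffD1, OF order_trans]) simp
  qed
  also have "\<dots> \<le> (\<Sum>s\<in>UNIV. (sqrt (?D s))\<^sup>2) * (\<Sum>s\<in>UNIV. (sqrt (?D s) * \<bar>?g s\<bar>)\<^sup>2)"
    by (rule Cauchy_Schwarz_ineq_sum)
  also have "\<dots> = 2 * total_variation m1 m2 * (\<Sum>s\<in>UNIV. ?D s * (?g s)\<^sup>2)"
    by (simp add: total_variation_def power_mult_distrib)
  also have "\<dots> \<le> 2 * total_variation m1 m2 * ((\<Sum>s\<in>UNIV. m1 s * (?g s)\<^sup>2) + (\<Sum>s\<in>UNIV. m2 s * (?g s)\<^sup>2))"
  proof (rule mult_left_mono)
    have "?D s * (?g s)\<^sup>2 \<le> m1 s * (?g s)\<^sup>2 + m2 s * (?g s)\<^sup>2" for s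
    proof -
      have "?D s \<le> m1 s + m2 s" using m1(1)[of s] m2(1)[of s] by linarith
      then show ?thesis by (metis distrib_right mult_right_mono zero_le_power2)
    qed
    then show "(\<Sum>s\<in>UNIV. ?D s * (?g s)\<^sup>2) \<le> (\<Sum>s\<in>UNIV. m1 s * (?g s)\<^sup>2) + (\<Sum>s\<in>UNIV. m2 s * (?g s)\<^sup>2)"
      by (simp add: sum_mono flip: sum.distrib)
  qed (simp add: total_variation_nonneg)
  also have "\<dots> \<le> 2 * total_variation m1 m2 * (2 * V + a\<^sup>2 / 2)"
  proof (rule mult_left_mono)
    have "(\<Sum>s\<in>UNIV. m1 s * (?g s)\<^sup>2) \<le> a\<^sup>2 / 4 + V"
      using sq1 unfolding gsq mean1 m1(2) by (simp add: power2_eq_square)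
    moreover have "(\<Sum>s\<in>UNIV. m2 s * (?g s)\<^sup>2) \<le> a\<^sup>2 / 4 + V"
      using sq2 by (simp add: gsq mean2 m2)
    ultimately show "(\<Sum>s\<in>UNIV. m1 s * (?g s)\<^sup>2) + (\<Sum>s\<in>UNIV. m2 s * (?g s)\<^sup>2) \<le> 2 * V + a\<^sup>2 / 2"
      by simp
  qed (simp add: total_variation_nonneg)
  finally show ?thesis by (simp add: algebra_simps)
qed

section \<open>Noise and copying\<close>

definition spin :: "bool \<Rightarrow> real" where
  "spin b = (if b then 1 else - 1)"

lemma spin_simps [simp]: "spin True = 1" "spin False = - 1" "spin (\<not> b) = - spin b"
  by (auto simp: spin_def)

lemma spin_mult_self [simp]: "spin b * spin b = 1"
  by (simp add: spin_def)

text \<open>The conditional probability of the output bit \<open>b\<close> given the input bit \<open>a\<close>: with probability \<open>\<theta>\<close>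
  the bit is kept, and otherwise it is replaced by a fair one. Rerandomization at rate 1 for a time
  \<open>t\<close> has \<open>\<theta> = exp (- t)\<close>.\<close>

definition noise_bit :: "real \<Rightarrow> bool \<Rightarrow> bool \<Rightarrow> real" where
  "noise_bit \<theta> a b = (1 + \<theta> * spin a * spin b) / 2"

definition noise :: "real \<Rightarrow> ('a::finite \<Rightarrow> bool) kernel" where
  "noise \<theta> = Kernel (\<lambda>\<eta> \<zeta>. \<Prod>x\<in>UNIV. noise_bit \<theta> (\<eta> x) (\<zeta> x))"

definition copy :: "('a::finite \<Rightarrow> 'a) \<Rightarrow> ('a \<Rightarrow> bool) kernel" where
  "copy \<phi> = Kernel (\<lambda>\<eta> \<zeta>. of_bool (\<zeta> = \<eta> \<circ> \<phi>))"

lemma noise_bit_nonneg: "\<lbrakk>0 \<le> \<theta>; \<theta> \<le> 1\<rbrakk> \<Longrightarrow> 0 \<le> noise_bit \<theta> a b"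
  by (cases a; cases b) (auto simp: noise_bit_def)

lemma noise_bit_sum: "(\<Sum>b\<in>UNIV. noise_bit \<theta> a b) = 1"
  by (simp add: UNIV_bool noise_bit_def field_simps)

lemma noise_bit_mult: "(\<Sum>b\<in>UNIV. noise_bit \<theta> a b * noise_bit \<theta>' b c) = noise_bit (\<theta> * \<theta>') a c"
  by (cases a; cases c) (simp_all add: UNIV_bool noise_bit_def field_simps)

lemma sum_fun_prod:
  "(\<Sum>\<xi>\<in>UNIV. \<Prod>x\<in>UNIV. g x (\<xi> x)) = (\<Prod>x\<in>UNIV. \<Sum>v\<in>UNIV. g x v)"
  for g :: "'a::finite \<Rightarrow> 'b::finite \<Rightarrow> real"
  using prod_sum_PiE[of "UNIV :: 'a set" "\<lambda>_. UNIV :: 'b set" g] by simp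

text \<open>Under a product weight, the coordinate \<open>y\<close> separates from the others.\<close>

lemma sum_fun_prod_marginal:
  fixes g :: "'a::finite \<Rightarrow> 'b::finite \<Rightarrow> real"
  shows "(\<Sum>\<xi>\<in>UNIV. (\<Prod>x\<in>UNIV. g x (\<xi> x)) * h (\<xi> y))
    = (\<Sum>v\<in>UNIV. g y v * h v) * (\<Prod>x\<in>UNIV - {y}. \<Sum>v\<in>UNIV. g x v)"
proof -
  let ?g = "\<lambda>x v. if x = y then g y v * h v else g x v"
  have "(\<Prod>x\<in>UNIV. g x (\<xi> x)) * h (\<xi> y) = (\<Prod>x\<in>UNIV. ?g x (\<xi> x))" for \<xi>
    by (subst (1 2) prod.remove[of _ y]) (auto intro!: prod.cong)
  then have "(\<Sum>\<xi>\<in>UNIV. (\<Prod>x\<in>UNIV. g x (\<xi> x)) * h (\<xi> y)) = (\<Prod>x\<in>UNIV. \<Sum>v\<in>UNIV. ?g x v)"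
    using sum_fun_prod[of ?g] by simp
  also have "\<dots> = (\<Sum>v\<in>UNIV. g y v * h v) * (\<Prod>x\<in>UNIV - {y}. \<Sum>v\<in>UNIV. g x v)"
    by (subst prod.remove[of _ y]) (auto intro!: prod.cong)
  finally show ?thesis .
qed

lemma noise_mult: "noise \<theta> * noise \<theta>' = noise (\<theta> * \<theta>')"
proof (rule kernel_eqI)
  fix \<eta> \<zeta> :: "'a \<Rightarrow> bool"
  show "entry (noise \<theta> * noise \<theta>') \<eta> \<zeta> = entry (noise (\<theta> * \<theta>')) \<eta> \<zeta>"
    using sum_fun_prod[of "\<lambda>x b. noise_bit \<theta> (\<eta> x) b * noise_bit \<theta>' b (\<zeta> x)"]
    by (simp add: noise_def entry_mult noise_bit_mult prod.distrib)
qed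

lemma noise_one: "noise 1 = 1"
proof (intro kernel_eqI)
  fix \<eta> \<zeta> :: "'a \<Rightarrow> bool"
  have "noise_bit 1 a b = of_bool (a = b)" for a b
    by (cases a; cases b) (auto simp: noise_bit_def)
  then show "entry (noise 1) \<eta> \<zeta> = entry 1 \<eta> \<zeta>"
    by (auto simp: noise_def entry_one fun_eq_iff prod_zero_iff)
qed

lemma stochastic_noise: "\<lbrakk>0 \<le> \<theta>; \<theta> \<le> 1\<rbrakk> \<Longrightarrow> stochastic (noise \<theta>)"
  using sum_fun_prod[of "\<lambda>x. noise_bit \<theta> (_ x)"]
  by (auto simp: stochastic_def noise_def noise_bit_sum intro!: prod_nonneg noise_bit_nonneg)

lemma stochastic_copy: "stochastic (copy \<phi>)"
  by (auto simp: stochastic_def copy_def of_bool_def)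

lemma act_copy: "act (copy \<phi>) f \<eta> = f (\<eta> \<circ> \<phi>)"
  by (simp add: act_def copy_def of_bool_def if_distrib if_distribR cong: if_cong)

lemma entry_copy_mult: "entry (copy \<phi> * A) \<eta> \<zeta> = entry A (\<eta> \<circ> \<phi>) \<zeta>"
  by (simp add: entry_mult copy_def of_bool_def if_distrib if_distribR cong: if_cong)

lemma copy_mult: "copy \<phi> * copy \<psi> = copy (\<phi> \<circ> \<psi>)"
  by (intro kernel_eqI) (simp add: entry_copy_mult, simp add: copy_def comp_assoc)

lemma copy_id: "copy id = 1"
  by (intro kernel_eqI) (auto simp: copy_def entry_one)

section \<open>Shared noise as a garbling of independent noise\<close>

text \<open>Consider an unknown spin \<open>a\<close>, its hidden noisy version \<open>v\<close> with parameter \<open>\<kappa>\<close>, and several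
  observed noisy versions of \<open>v\<close> with parameter \<open>\<theta>\<close>, conditionally independent given \<open>v\<close>. If
  \<open>p\<close> and \<open>p'\<close> are the likelihoods of the observations under \<open>v = True\<close> and \<open>v = False\<close>, then
  \<open>evidence p p'\<close> is the posterior mean of the spin of \<open>v\<close> under a uniform prior.\<close>

definition evidence :: "real \<Rightarrow> real \<Rightarrow> real" where
  "evidence p p' = (p - p') / (p + p')"

text \<open>The likelihood ratio of \<open>m\<close> against \<open>m'\<close> observed spins is \<open>(A / B)\<close> to the integer power
  \<open>m - m'\<close>. So it is 1, or at least \<open>A / B\<close>, or at most \<open>B / A\<close>.\<close>

lemma likelihood_ratio:
  fixes A B :: real
  assumes "0 < B" "B < A"
  shows "A ^ m * B ^ m' = A ^ m' * B ^ m
    \<or> A * (A ^ m' * B ^ m) \<le> B * (A ^ m * B ^ m')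
    \<or> A * (A ^ m * B ^ m') \<le> B * (A ^ m' * B ^ m)"
proof -
  have *: "A * (A ^ j * B ^ k) \<le> B * (A ^ k * B ^ j)" if jk: "j < k" for j k
  proof -
    obtain d where k: "k = Suc (j + d)" using less_imp_Suc_add[OF jk] by auto
    have "B * (A ^ k * B ^ j) - A * (A ^ j * B ^ k) = A * B * (A ^ j * B ^ j) * (A ^ d - B ^ d)"
      by (simp add: k power_add algebra_simps)
    also have "\<dots> \<ge> 0"
      using assms by (intro mult_nonneg_nonneg) (auto intro: power_mono)
    finally show ?thesis by simp
  qed
  then show ?thesis
    by (cases m m' rule: linorder_cases) auto
qed

lemma prod_noise_bit:
  fixes \<zeta> :: "'a \<Rightarrow> bool"
  assumes "finite Y"
  shows "(\<Prod>x\<in>Y. noise_bit \<theta> v (\<zeta> x))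
    = (if v then ((1 + \<theta>) / 2) ^ card {x\<in>Y. \<zeta> x} * ((1 - \<theta>) / 2) ^ card {x\<in>Y. \<not> \<zeta> x}
       else ((1 + \<theta>) / 2) ^ card {x\<in>Y. \<not> \<zeta> x} * ((1 - \<theta>) / 2) ^ card {x\<in>Y. \<zeta> x})"
proof -
  have "(\<Prod>x\<in>Y. noise_bit \<theta> v (\<zeta> x))
      = (\<Prod>x\<in>{x\<in>Y. \<zeta> x}. noise_bit \<theta> v (\<zeta> x)) * (\<Prod>x\<in>{x\<in>Y. \<not> \<zeta> x}. noise_bit \<theta> v (\<zeta> x))"
    using assms by (subst prod.union_disjoint[symmetric]) (auto intro!: prod.cong)
  then show ?thesis
    by (auto simp: noise_bit_def)
qed

text \<open>The observations either cancel or count at least as much as a single one of them. This gap is what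
  makes the probabilities in \<open>revise_nonneg\<close> nonnegative. It rests on all observations having
  the same noise parameter.\<close>

lemma evidence_dichotomy:
  fixes \<zeta> :: "'a \<Rightarrow> bool"
  assumes "finite Y" and \<theta>: "0 \<le> \<theta>" "\<theta> < 1"
  defines "p \<equiv> \<lambda>v. \<Prod>x\<in>Y. noise_bit \<theta> v (\<zeta> x)"
  defines "l \<equiv> evidence (p True) (p False)"
  shows "\<bar>l\<bar> < 1" and "l = 0 \<or> \<theta> \<le> \<bar>l\<bar>"
proof -
  have pos: "0 < p v" for v
    unfolding p_def using \<theta> by (intro prod_pos) (auto simp: noise_bit_def spin_def)
  from pos[of True] pos[of False] show "\<bar>l\<bar> < 1"
    by (simp add: l_def evidence_def abs_if field_simps)
  show "l = 0 \<or> \<theta> \<le> \<bar>l\<bar>"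
  proof (cases "\<theta> = 0")
    case False
    have "p True = p False
      \<or> (1 + \<theta>) / 2 * p False \<le> (1 - \<theta>) / 2 * p True
      \<or> (1 + \<theta>) / 2 * p True \<le> (1 - \<theta>) / 2 * p False"
      using likelihood_ratio[of "(1 - \<theta>) / 2" "(1 + \<theta>) / 2"
          "card {x\<in>Y. \<zeta> x}" "card {x\<in>Y. \<not> \<zeta> x}"] \<theta> False
      unfolding p_def prod_noise_bit[OF assms(1)] by auto
    then consider "p True = p False" | "\<theta> * (p True + p False) \<le> p True - p False"
      | "\<theta> * (p True + p False) \<le> p False - p True"
      by (auto simp: field_simps)
    then show ?thesis
    proof cases
      case 1
      then show ?thesis by (simp add: l_def evidence_def)
    next
      case 2
      then have "\<theta> \<le> l" using pos[of True] pos[of False]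
        by (simp add: l_def evidence_def pos_le_divide_eq add_pos_pos)
      then have "\<theta> \<le> \<bar>l\<bar>" by linarith
      then show ?thesis ..
    next
      case 3
      then have "\<theta> \<le> (p False - p True) / (p True + p False)" using pos[of True] pos[of False]
        by (simp add: pos_le_divide_eq add_pos_pos)
      also have "\<dots> = - l"
        by (simp add: l_def evidence_def minus_divide_left)
      finally have "\<theta> \<le> - l" .
      then have "\<theta> \<le> \<bar>l\<bar>" by linarith
      then show ?thesis ..
    qed
  qed simp
qed

text \<open>A further bit \<open>b\<close> is observed, which is a noisy version of \<open>a\<close> with parameter \<open>\<kappa> \<theta>\<close>, independent
  of \<open>v\<close> given \<open>a\<close>. It is to be turned into a bit \<open>c\<close> that behaves like one more noisy version
  of \<open>v\<close> with parameter \<open>\<theta>\<close>. The mean of the spin of \<open>c\<close> given \<open>b\<close> and the other observations is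
  taken to be \<open>bias + trust * spin b\<close>. Given \<open>a\<close> instead of \<open>b\<close>, it is then
  \<open>bias + trust * \<kappa> \<theta> spin a\<close>, and it should be \<open>\<theta>\<close> times the posterior mean of the spin of \<open>v\<close>, which
  is \<open>(l + \<kappa> spin a) / (1 + l \<kappa> spin a)\<close> where \<open>l\<close> is the evidence of the other observations.
  Equating the two for both values of \<open>a\<close> gives the formulas for \<open>bias\<close> and \<open>trust\<close>.\<close>

definition bias :: "real \<Rightarrow> real \<Rightarrow> real \<Rightarrow> real" where
  "bias \<kappa> \<theta> l = \<theta> * l * (1 - \<kappa>\<^sup>2) / (1 - l\<^sup>2 * \<kappa>\<^sup>2)"

definition trust :: "real \<Rightarrow> real \<Rightarrow> real" where
  "trust \<kappa> l = (1 - l\<^sup>2) / (1 - l\<^sup>2 * \<kappa>\<^sup>2)"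

definition revise :: "real \<Rightarrow> real \<Rightarrow> real \<Rightarrow> bool \<Rightarrow> bool \<Rightarrow> real" where
  "revise \<kappa> \<theta> l b c = (1 + spin c * (bias \<kappa> \<theta> l + trust \<kappa> l * spin b)) / 2"

lemma revise_sum: "(\<Sum>c\<in>UNIV. revise \<kappa> \<theta> l b c) = 1"
  by (simp add: UNIV_bool revise_def field_simps)

lemma revise_denominator_pos:
  fixes \<kappa> l :: real
  assumes \<kappa>: "0 \<le> \<kappa>" "\<kappa> \<le> 1" and l: "\<bar>l\<bar> < 1"
  shows "0 < 1 - l\<^sup>2 * \<kappa>\<^sup>2"
proof -
  have "l\<^sup>2 < 1" using l by (simp add: abs_square_less_1)
  moreover have "\<kappa>\<^sup>2 \<le> 1" using \<kappa> by (simp add: power_le_one)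
  ultimately have "l\<^sup>2 * \<kappa>\<^sup>2 \<le> l\<^sup>2 * 1" by (intro mult_left_mono) auto
  with \<open>l\<^sup>2 < 1\<close> show ?thesis by simp
qed

text \<open>Clearing denominators, \<open>\<bar>bias\<bar> + \<bar>trust\<bar> \<le> 1\<close> says \<open>\<theta> \<bar>l\<bar> (1 - \<kappa>\<^sup>2) \<le> l\<^sup>2 (1 - \<kappa>\<^sup>2)\<close>, which holds because
  \<open>l\<close> is 0 or at least \<open>\<theta>\<close> in absolute value.\<close>

lemma revise_nonneg:
  assumes \<kappa>: "0 \<le> \<kappa>" "\<kappa> \<le> 1" and \<theta>: "0 \<le> \<theta>" and l: "\<bar>l\<bar> < 1" "l = 0 \<or> \<theta> \<le> \<bar>l\<bar>"
  shows "0 \<le> revise \<kappa> \<theta> l b c"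
proof -
  note D = revise_denominator_pos[OF \<kappa> l(1)]
  have k1: "\<kappa>\<^sup>2 \<le> 1" using \<kappa> by (simp add: power_le_one)
  have l1: "l\<^sup>2 \<le> 1" using l by (simp add: abs_square_le_1)
  have "\<theta> * \<bar>l\<bar> \<le> l\<^sup>2"
    using l(2) mult_right_mono[of \<theta> "\<bar>l\<bar>" "\<bar>l\<bar>"] by (auto simp: power2_eq_square)
  then have "\<theta> * \<bar>l\<bar> * (1 - \<kappa>\<^sup>2) \<le> l\<^sup>2 * (1 - \<kappa>\<^sup>2)"
    using k1 by (intro mult_right_mono) auto
  then have "\<theta> * \<bar>l\<bar> * (1 - \<kappa>\<^sup>2) + (1 - l\<^sup>2) \<le> 1 - l\<^sup>2 * \<kappa>\<^sup>2"
    by (simp add: algebra_simps)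
  then have "\<bar>bias \<kappa> \<theta> l\<bar> + \<bar>trust \<kappa> l\<bar> \<le> 1"
    using D \<theta> k1 l1 by (simp add: bias_def trust_def abs_mult divide_le_eq_1 flip: add_divide_distrib)
  then show ?thesis
    by (auto simp: revise_def spin_def abs_if split: if_splits)
qed

text \<open>The joint law of the other observations and \<open>c\<close>, given \<open>a\<close>: on the left \<open>c\<close> is produced from \<open>b\<close>
  and the observations, on the right it is produced from \<open>v\<close> directly. With \<open>\<tau> = \<kappa> spin a\<close> and
  \<open>\<tau>\<^sup>2 = \<kappa>\<^sup>2\<close> this reduces to the factorization \<open>l (1 - \<tau>\<^sup>2) + (1 - l\<^sup>2) \<tau> = (l + \<tau>) (1 - l \<tau>)\<close>.\<close>

lemma revise_correct:
  assumes \<kappa>: "0 \<le> \<kappa>" "\<kappa> \<le> 1" and p: "0 < p True" "0 < p False"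
  defines "l \<equiv> evidence (p True) (p False)"
  shows "(\<Sum>v\<in>UNIV. noise_bit \<kappa> a v * p v) * (\<Sum>b\<in>UNIV. noise_bit (\<kappa> * \<theta>) a b * revise \<kappa> \<theta> l b c)
    = (\<Sum>v\<in>UNIV. noise_bit \<kappa> a v * p v * noise_bit \<theta> v c)"
proof -
  define P where "P = p True + p False"
  have P: "0 < P" using p by (simp add: P_def)
  have "\<bar>l\<bar> < 1"
    using p by (simp add: l_def evidence_def abs_if field_simps)
  note D = revise_denominator_pos[OF \<kappa> this]
  define \<tau> where "\<tau> = \<kappa> * spin a"
  have \<tau>2: "\<tau>\<^sup>2 = \<kappa>\<^sup>2" by (simp add: \<tau>_def power_mult_distrib power2_eq_square[of "spin a"])
  have pT: "p True = P * (1 + l) / 2" and pF: "p False = P * (1 - l) / 2"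
  proof -
    have "P * l = p True - p False"
      using P by (simp add: l_def evidence_def P_def)
    then show "p True = P * (1 + l) / 2" "p False = P * (1 - l) / 2"
      by (simp_all add: distrib_left right_diff_distrib) (simp_all add: P_def)
  qed
  have s1: "(\<Sum>v\<in>UNIV. noise_bit \<kappa> a v * p v) = P / 2 * (1 + \<tau> * l)"
    by (simp add: UNIV_bool pT pF noise_bit_def \<tau>_def field_simps)
  have s2: "(\<Sum>b\<in>UNIV. noise_bit (\<kappa> * \<theta>) a b * revise \<kappa> \<theta> l b c)
      = (1 + spin c * (bias \<kappa> \<theta> l + trust \<kappa> l * \<theta> * \<tau>)) / 2"
    by (simp add: UNIV_bool noise_bit_def revise_def \<tau>_def field_simps)
  have s3: "(\<Sum>v\<in>UNIV. noise_bit \<kappa> a v * p v * noise_bit \<theta> v c)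
      = P / 4 * (1 + \<tau> * l + \<theta> * spin c * (l + \<tau>))"
    by (simp add: UNIV_bool pT pF noise_bit_def \<tau>_def field_simps)
  have "(1 + \<tau> * l) * (bias \<kappa> \<theta> l + trust \<kappa> l * \<theta> * \<tau>) = \<theta> * (l + \<tau>)"
  proof -
    have "(1 + \<tau> * l) * (\<theta> * l * (1 - \<kappa>\<^sup>2) + (1 - l\<^sup>2) * \<theta> * \<tau>) = \<theta> * (l + \<tau>) * (1 - l\<^sup>2 * \<kappa>\<^sup>2)"
      unfolding \<tau>2[symmetric] by algebra
    then have "(1 + \<tau> * l) * ((\<theta> * l * (1 - \<kappa>\<^sup>2) + (1 - l\<^sup>2) * \<theta> * \<tau>) / (1 - l\<^sup>2 * \<kappa>\<^sup>2)) = \<theta> * (l + \<tau>)"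
      using D by (simp add: field_simps)
    then show ?thesis
      by (simp add: bias_def trust_def add_divide_distrib)
  qed
  moreover have "(1 + \<tau> * l) * (1 + spin c * X) = 1 + \<tau> * l + spin c * ((1 + \<tau> * l) * X)" for X
    by (simp add: algebra_simps)
  ultimately have "(1 + \<tau> * l) * (1 + spin c * (bias \<kappa> \<theta> l + trust \<kappa> l * \<theta> * \<tau>))
      = 1 + \<tau> * l + spin c * (\<theta> * (l + \<tau>))"
    by simp
  then show ?thesis
    unfolding s1 s2 s3 by (simp add: mult_ac)
qed

text \<open>An interpolation between copying after the first noise and copying before all noise. The sites
  in \<open>X\<close> receive noisy versions of the common noisy configuration \<open>\<xi>\<close>, the other sites receive
  independent noisy versions of the initial configuration.\<close>

definition partly_shared ::
    "real \<Rightarrow> real \<Rightarrow> ('a::finite \<Rightarrow> 'a) \<Rightarrow> 'a set \<Rightarrow> ('a \<Rightarrow> bool) kernel" where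
  "partly_shared \<kappa> \<theta> \<phi> X = Kernel (\<lambda>\<eta> \<zeta>. \<Sum>\<xi>\<in>UNIV.
     (\<Prod>y\<in>UNIV. noise_bit \<kappa> (\<eta> y) (\<xi> y)) * (\<Prod>x\<in>X. noise_bit \<theta> (\<xi> (\<phi> x)) (\<zeta> x)) *
     (\<Prod>x\<in>- X. noise_bit (\<kappa> * \<theta>) (\<eta> (\<phi> x)) (\<zeta> x)))"

text \<open>Moves the site \<open>z\<close> into \<open>X\<close>: its opinion is revised in view of the sites of \<open>X\<close> that have the same
  ancestor.\<close>

definition resample ::
    "real \<Rightarrow> real \<Rightarrow> ('a::finite \<Rightarrow> 'a) \<Rightarrow> 'a set \<Rightarrow> 'a \<Rightarrow> ('a \<Rightarrow> bool) kernel" where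
  "resample \<kappa> \<theta> \<phi> X z = Kernel (\<lambda>\<zeta> \<zeta>'.
     if \<forall>x. x \<noteq> z \<longrightarrow> \<zeta>' x = \<zeta> x
     then revise \<kappa> \<theta> (let p = \<lambda>v. \<Prod>x | x \<in> X \<and> \<phi> x = \<phi> z. noise_bit \<theta> v (\<zeta> x)
       in evidence (p True) (p False)) (\<zeta> z) (\<zeta>' z)
     else 0)"

lemma partly_shared_empty: "partly_shared \<kappa> \<theta> \<phi> {} = copy \<phi> * noise (\<kappa> * \<theta>)"
proof (rule kernel_eqI)
  fix \<eta> \<zeta> :: "'a \<Rightarrow> bool"
  show "entry (partly_shared \<kappa> \<theta> \<phi> {}) \<eta> \<zeta> = entry (copy \<phi> * noise (\<kappa> * \<theta>)) \<eta> \<zeta>"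
    using sum_fun_prod[of "\<lambda>y. noise_bit \<kappa> (\<eta> y)"]
    by (simp add: partly_shared_def entry_copy_mult noise_def noise_bit_sum flip: sum_distrib_right)
qed

lemma partly_shared_UNIV: "partly_shared \<kappa> \<theta> \<phi> UNIV = noise \<kappa> * (copy \<phi> * noise \<theta>)"
proof (rule kernel_eqI)
  fix \<eta> \<zeta> :: "'a \<Rightarrow> bool"
  show "entry (partly_shared \<kappa> \<theta> \<phi> UNIV) \<eta> \<zeta> = entry (noise \<kappa> * (copy \<phi> * noise \<theta>)) \<eta> \<zeta>"
    by (simp only: entry_mult[of "noise \<kappa>"] entry_copy_mult) (simp add: partly_shared_def noise_def)
qed

lemma sum_single_site:
  fixes \<zeta> :: "'a::finite \<Rightarrow> 'b::finite" and h :: "('a \<Rightarrow> 'b) \<Rightarrow> real"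
  shows "(\<Sum>\<zeta>'\<in>UNIV. if \<forall>x. x \<noteq> z \<longrightarrow> \<zeta>' x = \<zeta> x then h \<zeta>' else 0) = (\<Sum>c\<in>UNIV. h (\<zeta>(z := c)))"
proof -
  have "{\<zeta>'. \<forall>x. x \<noteq> z \<longrightarrow> \<zeta>' x = \<zeta> x} = (\<lambda>c. \<zeta>(z := c)) ` UNIV"
    by (auto simp: image_def fun_eq_iff)
  moreover have "inj (\<lambda>c. \<zeta>(z := c))"
    by (rule injI) (metis fun_upd_same)
  ultimately show ?thesis
    by (simp add: sum.reindex flip: sum.inter_filter)
qed

lemma stochastic_resample:
  assumes \<kappa>: "0 \<le> \<kappa>" "\<kappa> \<le> 1" and \<theta>: "0 \<le> \<theta>" "\<theta> < 1"
  shows "stochastic (resample \<kappa> \<theta> \<phi> X z)"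
  unfolding stochastic_def
proof (intro conjI allI)
  fix \<zeta> \<zeta>' :: "'a \<Rightarrow> bool"
  show "0 \<le> entry (resample \<kappa> \<theta> \<phi> X z) \<zeta> \<zeta>'"
    using evidence_dichotomy[OF _ \<theta>, of "{x. x \<in> X \<and> \<phi> x = \<phi> z}" \<zeta>]
    by (auto simp: resample_def Let_def intro!: revise_nonneg \<kappa> \<theta>)
next
  fix \<zeta> :: "'a \<Rightarrow> bool"
  show "(\<Sum>\<zeta>'\<in>UNIV. entry (resample \<kappa> \<theta> \<phi> X z) \<zeta> \<zeta>') = 1"
    by (simp add: resample_def sum_single_site revise_sum)
qed

text \<open>The sum over \<open>\<xi>\<close> factors over the sites. Only the factor at \<open>\<phi> z\<close> changes when \<open>z\<close> joins \<open>X\<close>,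
  and for that factor the claim is \<open>revise_correct\<close>.\<close>

lemma partly_shared_resample:
  assumes \<kappa>: "0 \<le> \<kappa>" "\<kappa> \<le> 1" and \<theta>: "0 \<le> \<theta>" "\<theta> < 1" and z: "z \<notin> X"
  shows "partly_shared \<kappa> \<theta> \<phi> X * resample \<kappa> \<theta> \<phi> X z = partly_shared \<kappa> \<theta> \<phi> (insert z X)"
proof (rule kernel_eqI)
  fix \<eta> \<zeta> :: "'a \<Rightarrow> bool"
  let ?y = "\<phi> z"
  define p where "p v = (\<Prod>x | x \<in> X \<and> \<phi> x = ?y. noise_bit \<theta> v (\<zeta> x))" for v
  define l where "l = evidence (p True) (p False)"
  define g where "g y v = noise_bit \<kappa> (\<eta> y) v * (\<Prod>x | x \<in> X \<and> \<phi> x = y. noise_bit \<theta> v (\<zeta> x))" for y v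
  define W where "W \<xi> = (\<Prod>y\<in>UNIV. g y (\<xi> y))" for \<xi>
  define C where "C = (\<Prod>x\<in>- insert z X. noise_bit (\<kappa> * \<theta>) (\<eta> (\<phi> x)) (\<zeta> x))"
  define R where "R = (\<Prod>y\<in>UNIV - {?y}. \<Sum>v\<in>UNIV. g y v)"
  have p_pos: "0 < p v" for v
    unfolding p_def using \<theta> by (intro prod_pos) (auto simp: noise_bit_def spin_def)
  have g_y: "g ?y v = noise_bit \<kappa> (\<eta> ?y) v * p v" for v
    by (simp add: g_def p_def)
  \<comment> \<open>Sort the shared sites by their ancestor.\<close>
  have W: "(\<Prod>y\<in>UNIV. noise_bit \<kappa> (\<eta> y) (\<xi> y)) * (\<Prod>x\<in>X. noise_bit \<theta> (\<xi> (\<phi> x)) (\<zeta> x)) = W \<xi>" for \<xi>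
  proof -
    have "(\<Prod>x\<in>X. noise_bit \<theta> (\<xi> (\<phi> x)) (\<zeta> x))
        = (\<Prod>y\<in>UNIV. \<Prod>x | x \<in> X \<and> \<phi> x = y. noise_bit \<theta> (\<xi> (\<phi> x)) (\<zeta> x))"
      by (rule prod.group[symmetric]) auto
    also have "\<dots> = (\<Prod>y\<in>UNIV. \<Prod>x | x \<in> X \<and> \<phi> x = y. noise_bit \<theta> (\<xi> y) (\<zeta> x))"
      by (intro prod.cong refl) auto
    finally show ?thesis by (simp add: W_def g_def prod.distrib)
  qed
  have "entry (partly_shared \<kappa> \<theta> \<phi> X) \<eta> (\<zeta>(z := b)) = (\<Sum>\<xi>\<in>UNIV. W \<xi>) * C * noise_bit (\<kappa> * \<theta>) (\<eta> ?y) b" for b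
  proof -
    have "(\<Prod>x\<in>X. noise_bit \<theta> (\<xi> (\<phi> x)) ((\<zeta>(z := b)) x)) = (\<Prod>x\<in>X. noise_bit \<theta> (\<xi> (\<phi> x)) (\<zeta> x))" for \<xi>
      using z by (intro prod.cong) auto
    moreover have "(\<Prod>x\<in>- X. noise_bit (\<kappa> * \<theta>) (\<eta> (\<phi> x)) ((\<zeta>(z := b)) x)) = noise_bit (\<kappa> * \<theta>) (\<eta> ?y) b * C"
      using z unfolding C_def by (subst prod.remove[of _ z]) (auto intro!: prod.cong)
    ultimately show ?thesis
      unfolding partly_shared_def entry_Kernel by (simp only: W) (simp add: sum_distrib_left sum_distrib_right mult_ac)
  qed
  moreover have "(let q = \<lambda>v. \<Prod>x | x \<in> X \<and> \<phi> x = ?y. noise_bit \<theta> v ((\<zeta>(z := b)) x)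
      in evidence (q True) (q False)) = l" for b
  proof -
    have "(\<Prod>x | x \<in> X \<and> \<phi> x = ?y. noise_bit \<theta> v ((\<zeta>(z := b)) x)) = p v" for v
      unfolding p_def using z by (intro prod.cong) auto
    then show ?thesis by (simp only: Let_def l_def)
  qed
  moreover have "entry (partly_shared \<kappa> \<theta> \<phi> X * resample \<kappa> \<theta> \<phi> X z) \<eta> \<zeta>
      = (\<Sum>b\<in>UNIV. entry (partly_shared \<kappa> \<theta> \<phi> X) \<eta> (\<zeta>(z := b)) * entry (resample \<kappa> \<theta> \<phi> X z) (\<zeta>(z := b)) \<zeta>)"
  proof -
    have "entry (partly_shared \<kappa> \<theta> \<phi> X) \<eta> \<xi> * entry (resample \<kappa> \<theta> \<phi> X z) \<xi> \<zeta>
      = (if \<forall>x. x \<noteq> z \<longrightarrow> \<xi> x = \<zeta> x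
         then entry (partly_shared \<kappa> \<theta> \<phi> X) \<eta> \<xi> * entry (resample \<kappa> \<theta> \<phi> X z) \<xi> \<zeta> else 0)" for \<xi>
      by (auto simp: resample_def)
    then show ?thesis unfolding entry_mult by (subst sum_single_site[symmetric]) simp
  qed
  ultimately have "entry (partly_shared \<kappa> \<theta> \<phi> X * resample \<kappa> \<theta> \<phi> X z) \<eta> \<zeta>
      = (\<Sum>b\<in>UNIV. (\<Sum>\<xi>\<in>UNIV. W \<xi>) * C * noise_bit (\<kappa> * \<theta>) (\<eta> ?y) b * revise \<kappa> \<theta> l b (\<zeta> z))"
    by (simp add: resample_def)
  also have "\<dots> = C * ((\<Sum>\<xi>\<in>UNIV. W \<xi> * 1) * (\<Sum>b\<in>UNIV. noise_bit (\<kappa> * \<theta>) (\<eta> ?y) b * revise \<kappa> \<theta> l b (\<zeta> z)))"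
    by (simp add: UNIV_bool algebra_simps)
  also have "\<dots> = C * (R * ((\<Sum>v\<in>UNIV. noise_bit \<kappa> (\<eta> ?y) v * p v) *
      (\<Sum>b\<in>UNIV. noise_bit (\<kappa> * \<theta>) (\<eta> ?y) b * revise \<kappa> \<theta> l b (\<zeta> z))))"
    unfolding W_def sum_fun_prod_marginal[where h = "\<lambda>_. 1" and y = ?y] g_y R_def by (simp add: mult_ac)
  also have "\<dots> = C * (R * (\<Sum>v\<in>UNIV. noise_bit \<kappa> (\<eta> ?y) v * p v * noise_bit \<theta> v (\<zeta> z)))"
    unfolding l_def using revise_correct[of \<kappa> p "\<eta> ?y" \<theta> "\<zeta> z", OF \<kappa> p_pos p_pos] by simp
  also have "\<dots> = C * (\<Sum>\<xi>\<in>UNIV. W \<xi> * noise_bit \<theta> (\<xi> ?y) (\<zeta> z))"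
    unfolding W_def sum_fun_prod_marginal[where h = "\<lambda>v. noise_bit \<theta> v (\<zeta> z)" and y = ?y] g_y R_def
    by (simp add: mult_ac)
  also have "\<dots> = entry (partly_shared \<kappa> \<theta> \<phi> (insert z X)) \<eta> \<zeta>"
    using z by (simp add: partly_shared_def C_def[symmetric] W[symmetric] sum_distrib_left mult_ac)
  finally show "entry (partly_shared \<kappa> \<theta> \<phi> X * resample \<kappa> \<theta> \<phi> X z) \<eta> \<zeta>
      = entry (partly_shared \<kappa> \<theta> \<phi> (insert z X)) \<eta> \<zeta>" .
qed

text \<open>Noise applied before copying is shared by all sites that copy from the same site. It can be
  replaced by independent noise after copying, at the price of a garbling \<open>K\<close> that does not depend on
  the configuration.\<close>

lemma noise_copy_noise_factors:
  fixes \<phi> :: "'a::finite \<Rightarrow> 'a"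
  assumes \<kappa>: "0 \<le> \<kappa>" "\<kappa> \<le> 1" and \<theta>: "0 \<le> \<theta>" "\<theta> < 1"
  obtains K where "stochastic K" "noise \<kappa> * (copy \<phi> * noise \<theta>) = copy \<phi> * noise (\<kappa> * \<theta>) * K"
proof -
  have "finite X \<Longrightarrow> \<exists>K. stochastic K \<and> partly_shared \<kappa> \<theta> \<phi> X = copy \<phi> * noise (\<kappa> * \<theta>) * K" for X
  proof (induction X rule: finite_induct)
    case empty
    show ?case
      using stochastic_one by (intro exI[of _ 1]) (simp add: partly_shared_empty)
  next
    case (insert z X)
    then obtain K where "stochastic K" "partly_shared \<kappa> \<theta> \<phi> X = copy \<phi> * noise (\<kappa> * \<theta>) * K" by blast
    then show ?case
      using stochastic_mult[OF _ stochastic_resample[OF \<kappa> \<theta>]] insert.hyps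
      by (metis partly_shared_resample[OF \<kappa> \<theta>] mult.assoc)
  qed
  from this[of UNIV] show thesis
    using that by (auto simp: partly_shared_UNIV)
qed

section \<open>The noisy voter semigroup\<close>

lemma act_gen_nvm:
  "act (gen (nvm_rate q)) f \<eta> = (\<Sum>x\<in>UNIV. flip_rate q \<eta> x * (f (\<eta>(x := \<not> \<eta> x)) - f \<eta>))"
proof -
  have "act (gen (nvm_rate q)) f \<eta>
      = (\<Sum>\<zeta>\<in>UNIV. \<Sum>x\<in>UNIV. if \<zeta> = \<eta>(x := \<not> \<eta> x) then flip_rate q \<eta> x * (f \<zeta> - f \<eta>) else 0)"
    unfolding act_gen nvm_rate_def
    by (simp add: sum_distrib_right sum.inter_filter[symmetric])
  also have "\<dots> = (\<Sum>x\<in>UNIV. flip_rate q \<eta> x * (f (\<eta>(x := \<not> \<eta> x)) - f \<eta>))"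
    by (subst sum.swap) simp
  finally show ?thesis .
qed

text \<open>The generator of the voter model without noise. Replacing the state at \<open>x\<close> by the state at \<open>y\<close> is
  the copying map \<open>id(x := y)\<close>.\<close>

definition voter :: "('a::finite \<Rightarrow> 'a \<Rightarrow> real) \<Rightarrow> ('a \<Rightarrow> bool) kernel" where
  "voter q = (\<Sum>x\<in>UNIV. \<Sum>y\<in>UNIV - {x}. q x y *\<^sub>R (copy (id(x := y)) - 1))"

lemma comp_id_fun_upd: "\<eta> \<circ> id(x := y) = \<eta>(x := \<eta> y)"
  by (auto simp: fun_eq_iff)

lemma act_voter:
  "act (voter q) f \<eta> = (\<Sum>x\<in>UNIV. \<Sum>y\<in>UNIV - {x}. q x y * (f (\<eta>(x := \<eta> y)) - f \<eta>))"
  by (simp only: voter_def act_sum act_scaleR act_diff act_copy comp_id_fun_upd act_one)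

text \<open>The imitation part of the rate can be counted at every pair of sites, because copying an equal
  opinion changes nothing.\<close>

lemma gen_nvm_split: "gen (nvm_rate q) = voter q + gen (nvm_rate (\<lambda>_ _. 0))"
proof (rule kernel_eq_actI, rule ext)
  fix f :: "('a \<Rightarrow> bool) \<Rightarrow> real" and \<eta>
  have "flip_rate q \<eta> x * (f (\<eta>(x := \<not> \<eta> x)) - f \<eta>)
      = (\<Sum>y\<in>UNIV - {x}. q x y * (f (\<eta>(x := \<eta> y)) - f \<eta>))
        + flip_rate (\<lambda>_ _. 0) \<eta> x * (f (\<eta>(x := \<not> \<eta> x)) - f \<eta>)" for x
  proof -
    have "(\<Sum>y\<in>UNIV - {x}. q x y * (f (\<eta>(x := \<eta> y)) - f \<eta>))
        = (\<Sum>y\<in>UNIV - {x}. q x y * (if \<eta> x then 1 - of_bool (\<eta> y) else of_bool (\<eta> y)))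
          * (f (\<eta>(x := \<not> \<eta> x)) - f \<eta>)"
      unfolding sum_distrib_right
    proof (intro sum.cong refl)
      fix y
      show "q x y * (f (\<eta>(x := \<eta> y)) - f \<eta>)
          = q x y * (if \<eta> x then 1 - of_bool (\<eta> y) else of_bool (\<eta> y)) * (f (\<eta>(x := \<not> \<eta> x)) - f \<eta>)"
        by (cases "\<eta> x"; cases "\<eta> y") (simp_all add: fun_upd_idem)
    qed
    then show ?thesis
      by (cases "\<eta> x") (simp_all add: flip_rate_def distrib_right)
  qed
  then have "act (gen (nvm_rate q)) f \<eta> = act (voter q) f \<eta> + act (gen (nvm_rate (\<lambda>_ _. 0))) f \<eta>"
    unfolding act_gen_nvm act_voter by (simp only: sum.distrib)
  then show "act (gen (nvm_rate q)) f \<eta> = act (voter q + gen (nvm_rate (\<lambda>_ _. 0))) f \<eta>"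
    by (simp only: act_add)
qed

lemma flip_rate_zero: "flip_rate (\<lambda>_ _. 0) \<eta> x = 1 / 2"
  by (simp add: flip_rate_def)

text \<open>The product rule at \<open>\<theta> = 1\<close>: the term of the site \<open>x\<close> vanishes unless the two configurations agree
  off \<open>x\<close>, so only single flips have a first order probability.\<close>

lemma noise_derivative:
  "((\<lambda>s. noise (exp (- s))) has_vector_derivative gen (nvm_rate (\<lambda>_ _. 0))) (at 0 within S)"
proof (rule has_vector_derivative_at_within, rule has_vector_derivative_kernelI)
  fix \<eta> \<zeta> :: "'a \<Rightarrow> bool"
  let ?G = "gen (nvm_rate (\<lambda>_ _. 0)) :: ('a \<Rightarrow> bool) kernel"
  have bit: "noise_bit (exp (- 0)) a b = of_bool (a = b)" for a b
    by (cases a; cases b) (auto simp: noise_bit_def)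
  have bit': "((\<lambda>s. noise_bit (exp (- s)) a b) has_real_derivative - (spin a * spin b / 2)) (at 0)" for a b
    unfolding noise_bit_def by (auto intro!: derivative_eq_intros)
  have flip: "- (spin (\<eta> x) * spin (\<zeta> x) / 2) * (\<Prod>y\<in>UNIV - {x}. noise_bit (exp (- 0)) (\<eta> y) (\<zeta> y))
      = 1 / 2 * (of_bool (\<eta>(x := \<not> \<eta> x) = \<zeta>) - of_bool (\<eta> = \<zeta>))" for x
  proof (cases "\<forall>y. y \<noteq> x \<longrightarrow> \<eta> y = \<zeta> y")
    case True
    then have 1: "(\<Prod>y\<in>UNIV - {x}. noise_bit (exp (- 0)) (\<eta> y) (\<zeta> y)) = 1"
      unfolding bit by (intro prod.neutral) auto
    have 2: "\<eta>(x := \<not> \<eta> x) = \<zeta> \<longleftrightarrow> \<zeta> x \<noteq> \<eta> x" "\<eta> = \<zeta> \<longleftrightarrow> \<zeta> x = \<eta> x"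
      using True by (auto simp: fun_eq_iff)
    show ?thesis unfolding 1 2 by (cases "\<eta> x"; cases "\<zeta> x") simp_all
  next
    case False
    then obtain y where y: "y \<noteq> x" "\<eta> y \<noteq> \<zeta> y" by blast
    then have 1: "(\<Prod>y\<in>UNIV - {x}. noise_bit (exp (- 0)) (\<eta> y) (\<zeta> y)) = 0"
      unfolding bit by (intro prod_zero) auto
    have 2: "\<eta>(x := \<not> \<eta> x) \<noteq> \<zeta>" "\<eta> \<noteq> \<zeta>" using y by auto
    show ?thesis unfolding 1 using 2 by simp
  qed
  have "entry ?G \<eta> \<zeta> = act ?G (\<lambda>\<xi>. of_bool (\<xi> = \<zeta>)) \<eta>"
    by (simp add: act_def of_bool_def if_distrib cong: if_cong)
  also have "\<dots> = (\<Sum>x\<in>UNIV. - (spin (\<eta> x) * spin (\<zeta> x) / 2) *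
      (\<Prod>y\<in>UNIV - {x}. noise_bit (exp (- 0)) (\<eta> y) (\<zeta> y)))"
    unfolding flip act_gen_nvm by (simp add: flip_rate_zero)
  finally show "((\<lambda>s. entry (noise (exp (- s))) \<eta> \<zeta>) has_real_derivative entry ?G \<eta> \<zeta>) (at 0)"
    using has_field_derivative_prod[where A = UNIV and z = 0
        and f = "\<lambda>x s. noise_bit (exp (- s)) (\<eta> x) (\<zeta> x)", OF bit']
    by (simp only: noise_def entry_Kernel)
qed

lemma noise_power: "noise \<theta> ^ n = noise (\<theta> ^ n)"
  by (induction n) (simp_all add: noise_one noise_mult)

lemma nvm_rate_nonneg:
  assumes q: "\<And>x y. x \<noteq> y \<Longrightarrow> 0 \<le> q x y"
  shows "0 \<le> nvm_rate q \<eta> \<zeta>"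
proof -
  have "0 \<le> q x y" if "y \<in> UNIV - {x}" for x y
    using q[of x y] that by blast
  then have "0 \<le> flip_rate q \<eta> x" for x
    by (auto simp: flip_rate_def intro!: add_nonneg_nonneg sum_nonneg mult_nonneg_nonneg)
  then show ?thesis
    by (auto simp: nvm_rate_def intro!: sum_nonneg)
qed

lemma stochastic_exp_nvm:
  assumes "\<And>x y. x \<noteq> y \<Longrightarrow> 0 \<le> q x y" and "0 \<le> s"
  shows "stochastic (exp (s *\<^sub>R gen (nvm_rate q)))"
  using assms by (intro stochastic_exp_gen nvm_rate_nonneg)

text \<open>The noise kernels form a semigroup, so each power in the product formula is already the limit.\<close>

lemma exp_noise_generator:
  assumes "0 \<le> t"
  shows "exp (t *\<^sub>R gen (nvm_rate (\<lambda>_ _. 0))) = (noise (exp (- t)) :: ('a::finite \<Rightarrow> bool) kernel)"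
proof (cases "t = 0")
  case False
  let ?G = "gen (nvm_rate (\<lambda>_ _. 0)) :: ('a \<Rightarrow> bool) kernel"
  have "(\<lambda>n. noise (exp (- (t / real n))) ^ n) \<longlonglongrightarrow> exp (t *\<^sub>R ?G)"
  proof (rule exp_eq_limit_of_powers)
    show "\<forall>\<^sub>F s in at_right 0. norm (noise (exp (- s)) :: ('a \<Rightarrow> bool) kernel) \<le> 1"
      using eventually_at_right_less[of 0]
      by eventually_elim (simp add: stochastic_norm_le stochastic_noise)
    show "norm (exp (s *\<^sub>R ?G)) \<le> 1" if "0 \<le> s" for s
      using that by (intro stochastic_norm_le stochastic_exp_nvm) auto
  qed (use assms False in \<open>auto simp: noise_one intro: noise_derivative\<close>)
  moreover have "\<forall>\<^sub>F n in sequentially. noise (exp (- (t / real n))) ^ n = noise (exp (- t))"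
    using eventually_gt_at_top[of 0]
    by eventually_elim (simp add: noise_power flip: exp_of_nat_mult)
  ultimately have "(\<lambda>n. noise (exp (- t))) \<longlonglongrightarrow> exp (t *\<^sub>R ?G)"
    by (rule Lim_transform_eventually)
  then show ?thesis
    using LIMSEQ_unique tendsto_const by blast
qed (simp add: noise_one)

section \<open>Comparison with the hypercube walk\<close>

text \<open>Mixtures of: copy the initial opinions along a map, apply independent noise, then garble in a way
  that may depend on the map but not on the opinions.\<close>

definition dominated :: "real \<Rightarrow> ('a::finite \<Rightarrow> bool) kernel set" where
  "dominated \<theta> = convex hull {copy \<phi> * noise \<theta> * K | \<phi> K. stochastic K}"

lemma hull_mult_left:
  fixes B :: "'b::real_algebra"
  assumes "M \<in> convex hull S" "convex C" "\<And>A. A \<in> S \<Longrightarrow> B * A \<in> C"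
  shows "B * M \<in> C"
proof -
  have "convex {M. B * M \<in> C}"
    using assms(2) by (auto simp: convex_def distrib_left)
  with assms(3) have "convex hull S \<subseteq> {M. B * M \<in> C}"
    by (intro hull_minimal) auto
  with assms(1) show ?thesis by auto
qed

lemma hull_mult_right:
  fixes M :: "'b::real_algebra"
  assumes "B \<in> convex hull S" "convex C" "\<And>A. A \<in> S \<Longrightarrow> A * M \<in> C"
  shows "B * M \<in> C"
proof -
  have "convex {B. B * M \<in> C}"
    using assms(2) by (auto simp: convex_def distrib_right)
  with assms(3) have "convex hull S \<subseteq> {B. B * M \<in> C}"
    by (intro hull_minimal) auto
  with assms(1) show ?thesis by auto
qed

lemma convex_dominated: "convex (dominated \<theta>)"
  by (simp add: dominated_def)

lemma dominated_copy_mult: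
  fixes M :: "('a::finite \<Rightarrow> bool) kernel"
  assumes "M \<in> dominated \<theta>" shows "copy \<phi> * M \<in> dominated \<theta>"
  using assms unfolding dominated_def
proof (rule hull_mult_left)
  fix A :: "('a \<Rightarrow> bool) kernel"
  assume "A \<in> {copy \<psi> * noise \<theta> * K | \<psi> K. stochastic K}"
  then obtain \<psi> K where "A = copy \<psi> * noise \<theta> * K" "stochastic K" by blast
  moreover have "copy \<phi> * (copy \<psi> * noise \<theta> * K) = copy (\<phi> \<circ> \<psi>) * noise \<theta> * K"
    by (simp only: copy_mult[symmetric] mult.assoc)
  ultimately show "copy \<phi> * A \<in> convex hull {copy \<psi> * noise \<theta> * K | \<psi> K. stochastic K}"
    by (auto intro!: hull_inc)
qed (rule convex_convex_hull)

text \<open>This is where shared noise enters: the noise \<open>\<kappa>\<close> precedes the copying and must be moved past it.\<close>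

lemma dominated_noise_mult:
  fixes M :: "('a::finite \<Rightarrow> bool) kernel"
  assumes \<kappa>: "0 \<le> \<kappa>" "\<kappa> \<le> 1" and \<theta>: "0 \<le> \<theta>" "\<theta> < 1" and M: "M \<in> dominated \<theta>"
  shows "noise \<kappa> * M \<in> dominated (\<kappa> * \<theta>)"
  using M unfolding dominated_def
proof (rule hull_mult_left)
  fix A :: "('a \<Rightarrow> bool) kernel"
  assume "A \<in> {copy \<psi> * noise \<theta> * K | \<psi> K. stochastic K}"
  then obtain \<psi> K where A: "A = copy \<psi> * noise \<theta> * K" "stochastic K" by blast
  obtain L where L: "stochastic L" "noise \<kappa> * (copy \<psi> * noise \<theta>) = copy \<psi> * noise (\<kappa> * \<theta>) * L"
    using noise_copy_noise_factors[OF \<kappa> \<theta>] .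
  have "noise \<kappa> * A = copy \<psi> * noise (\<kappa> * \<theta>) * (L * K)"
  proof -
    have "noise \<kappa> * A = noise \<kappa> * (copy \<psi> * noise \<theta>) * K"
      by (simp only: A(1) mult.assoc)
    then show ?thesis by (simp only: L(2) mult.assoc)
  qed
  with stochastic_mult[OF L(1) A(2)]
  show "noise \<kappa> * A \<in> convex hull {copy \<psi> * noise (\<kappa> * \<theta>) * K | \<psi> K. stochastic K}"
    by (auto intro!: hull_inc)
qed (rule convex_convex_hull)

text \<open>A short voting step copies at most one opinion. The probability that nothing is copied is spread
  evenly over the trivial copies \<open>id(x := x)\<close>, so that the convex combination is indexed by all pairs
  of sites.\<close>

lemma voter_step_in_hull:
  fixes q :: "'a::finite \<Rightarrow> 'a \<Rightarrow> real"
  assumes q: "\<And>x y. x \<noteq> y \<Longrightarrow> 0 \<le> q x y" and s: "0 \<le> s" "s * (\<Sum>x\<in>UNIV. \<Sum>y\<in>UNIV - {x}. q x y) \<le> 1"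
  shows "1 + s *\<^sub>R voter q \<in> convex hull (range copy)"
proof -
  define c where "c = (\<Sum>x\<in>UNIV. \<Sum>y\<in>UNIV - {x}. q x y)"
  define b where "b = (\<lambda>(x, y). if x = y then (1 - s * c) / CARD('a) else s * q x y)"
  have split: "(\<Sum>p\<in>UNIV. f p) = (\<Sum>x\<in>UNIV. f (x, x)) + (\<Sum>x\<in>UNIV. \<Sum>y\<in>UNIV - {x}. f (x, y))"
    for f :: "'a \<times> 'a \<Rightarrow> 'b::comm_monoid_add"
  proof -
    have "(\<Sum>p\<in>UNIV. f p) = (\<Sum>x\<in>UNIV. \<Sum>y\<in>UNIV. f (x, y))"
      by (simp only: sum.cartesian_product UNIV_Times_UNIV split_def prod.collapse)
    also have "\<dots> = (\<Sum>x\<in>UNIV. f (x, x) + (\<Sum>y\<in>UNIV - {x}. f (x, y)))"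
      by (intro sum.cong refl sum.remove) auto
    finally show ?thesis by (simp add: sum.distrib)
  qed
  have off: "(\<Sum>x\<in>UNIV. \<Sum>y\<in>UNIV - {x}. g x y (b (x, y)))
      = (\<Sum>x\<in>UNIV. \<Sum>y\<in>UNIV - {x}. g x y (s * q x y))" for g :: "'a \<Rightarrow> 'a \<Rightarrow> real \<Rightarrow> 'b::comm_monoid_add"
    by (intro sum.cong refl) (auto simp: b_def)
  have "(\<Sum>p\<in>UNIV. b p *\<^sub>R copy (id(fst p := snd p))) \<in> convex hull (range copy)"
  proof (rule convex_sum)
    show "sum b UNIV = 1"
      unfolding split using off[of "\<lambda>_ _ r. r"]
      by (simp add: b_def c_def flip: sum_distrib_left)
    show "0 \<le> b p" if "p \<in> UNIV" for p
      using s q by (auto simp: b_def c_def split: prod.splits)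
  qed (auto intro: hull_inc)
  also have "(\<Sum>p\<in>UNIV. b p *\<^sub>R copy (id(fst p := snd p))) = 1 + s *\<^sub>R voter q"
  proof -
    have diag: "(\<Sum>x\<in>UNIV. b (x, x) *\<^sub>R copy (id(x := x))) = (1 - s * c) *\<^sub>R (1 :: ('a \<Rightarrow> bool) kernel)"
      by (simp add: b_def fun_upd_idem copy_id sum_constant_scaleR del: sum_constant)
    have scaled: "s *\<^sub>R voter q = (\<Sum>x\<in>UNIV. \<Sum>y\<in>UNIV - {x}. (s * q x y) *\<^sub>R copy (id(x := y))) - (s * c) *\<^sub>R 1"
      by (simp add: voter_def c_def scaleR_sum_right scaleR_sum_left sum_distrib_left sum_subtractf
          scaleR_diff_right)
    show ?thesis
      unfolding split fst_conv snd_conv off[of "\<lambda>x y r. r *\<^sub>R copy (id(x := y))"] diag scaled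
      by (simp add: algebra_simps)
  qed
  finally show ?thesis .
qed

lemma convex_stochastic: "convex {K. stochastic K}"
  by (auto simp: convex_def stochastic_def sum.distrib simp flip: sum_distrib_left)

text \<open>By the product formula the transition kernel is the limit of \<open>F (t / n)\<close> to the power \<open>n\<close>, with
  \<open>F\<close> a voting step followed by noise. Multiplying by further factors \<open>F s\<close> on the left keeps the
  power in the dominated class, with the noise parameters \<open>exp (- s)\<close> accumulating to \<open>exp (- t)\<close>.\<close>

lemma total_variation_nvm_le_noise:
  fixes q :: "'a::finite \<Rightarrow> 'a \<Rightarrow> real"
  assumes q: "\<And>x y. x \<noteq> y \<Longrightarrow> 0 \<le> q x y" and t: "0 \<le> t"
    and d: "\<And>\<eta>1 \<eta>2 :: 'a \<Rightarrow> bool. total_variation (entry (noise (exp (- t))) \<eta>1) (entry (noise (exp (- t))) \<eta>2) \<le> d"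
  shows "total_variation (nvm_law q \<eta>1 t) (nvm_law q \<eta>2 t) \<le> d"
proof -
  let ?tv = "\<lambda>M :: ('a \<Rightarrow> bool) kernel. total_variation (entry M \<eta>1) (entry M \<eta>2)"
  let ?P = "exp (t *\<^sub>R gen (nvm_rate q))"
  have "?tv ?P \<le> d"
  proof (cases "t = 0")
    case True
    with d[of \<eta>1 \<eta>2] show ?thesis by (simp add: noise_one)
  next
    case False
    with t have t: "0 < t" by simp
    define F where "F s = (1 + s *\<^sub>R voter q) * noise (exp (- s))" for s
    define c where "c = (\<Sum>x\<in>UNIV. \<Sum>y\<in>UNIV - {x}. q x y)"
    have small: "\<forall>\<^sub>F s in at_right 0. s * c \<le> 1"
    proof -
      have "((\<lambda>s. s * c) \<longlongrightarrow> 0 * c) (at_right 0)"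
        by (intro tendsto_intros)
      then have "\<forall>\<^sub>F s in at_right 0. s * c < 1"
        by (rule order_tendstoD) simp
      then show ?thesis by eventually_elim simp
    qed
    have hull: "1 + s *\<^sub>R voter q \<in> convex hull (range copy)" if "0 < s" "s * c \<le> 1" for s
      using that q by (intro voter_step_in_hull) (auto simp: c_def)
    have F_stochastic: "stochastic (F s)" if "0 < s" "s * c \<le> 1" for s
    proof -
      have "convex hull (range copy) \<subseteq> {K :: ('a \<Rightarrow> bool) kernel. stochastic K}"
        by (rule hull_minimal) (auto simp: convex_stochastic stochastic_copy)
      with hull[OF that] that show ?thesis
        unfolding F_def by (intro stochastic_mult stochastic_noise) auto
    qed
    have lim: "(\<lambda>n. F (t / real n) ^ n) \<longlonglongrightarrow> ?P"
    proof (rule exp_eq_limit_of_powers)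
      show "F 0 = 1" by (simp add: F_def noise_one)
      have "((\<lambda>s. 1 + s *\<^sub>R voter q) has_vector_derivative voter q) (at 0 within {0..})"
        by (auto intro!: derivative_eq_intros)
      from has_vector_derivative_mult[OF this noise_derivative]
      show "(F has_vector_derivative gen (nvm_rate q)) (at 0 within {0..})"
        by (simp add: F_def[abs_def] noise_one gen_nvm_split[of q] add.commute)
      show "\<forall>\<^sub>F s in at_right 0. norm (F s) \<le> 1"
        using small eventually_at_right_less[of 0]
        by eventually_elim (simp add: stochastic_norm_le F_stochastic)
      show "norm (exp (s *\<^sub>R gen (nvm_rate q))) \<le> 1" if "0 \<le> s" for s
        using that q by (intro stochastic_norm_le stochastic_exp_nvm)
    qed fact
    have F_dominated: "F s ^ Suc n \<in> dominated (exp (- s) ^ Suc n)" if s: "0 < s" "s * c \<le> 1" for s n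
    proof -
      \<comment> \<open>A voting step averages over copying maps, and copying before a dominated kernel is harmless.\<close>
      have step: "(1 + s *\<^sub>R voter q) * M \<in> dominated \<theta>" if "M \<in> dominated \<theta>" for M \<theta>
        using hull[OF s] convex_dominated
        by (rule hull_mult_right) (auto intro: dominated_copy_mult that)
      show ?thesis
      proof (induction n)
        case 0
        have "copy id * noise (exp (- s)) * 1 \<in> dominated (exp (- s))"
          unfolding dominated_def using stochastic_one by (intro hull_inc) blast
        from step[OF this] show ?case
          by (simp add: F_def copy_id)
      next
        case (Suc n)
        have "exp (- s) ^ Suc n < 1"
          using s by (intro power_Suc_less_one) auto
        with Suc s have "noise (exp (- s)) * F s ^ Suc n \<in> dominated (exp (- s) * exp (- s) ^ Suc n)"
          by (intro dominated_noise_mult) auto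
        from step[OF this] show ?case
          by (simp add: F_def mult.assoc)
      qed
    qed
    have "\<forall>\<^sub>F n in sequentially. ?tv (F (t / real n) ^ n) \<le> d"
    proof -
      have "filterlim (\<lambda>n. t / real n) (at_right 0) sequentially"
        using t by (rule filterlim_over_n_at_right)
      from eventually_compose_filterlim[OF small this]
      show ?thesis
        using eventually_gt_at_top[of 0]
      proof eventually_elim
        case (elim n)
        then obtain m where n: "n = Suc m" by (cases n) auto
        have "F (t / real n) ^ n \<in> dominated (exp (- (t / real n)) ^ n)"
          unfolding n using elim t n by (intro F_dominated) auto
        also have "exp (- (t / real n)) ^ n = exp (- t)"
          using elim by (simp flip: exp_of_nat_mult)
        also have "dominated (exp (- t)) \<subseteq> {M. ?tv M \<le> d}"
          unfolding dominated_def
        proof (rule hull_minimal)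
          show "{copy \<phi> * noise (exp (- t)) * K |\<phi> K. stochastic K} \<subseteq> {M. ?tv M \<le> d}"
          proof safe
            fix \<phi> and K :: "('a \<Rightarrow> bool) kernel"
            assume "stochastic K"
            then have "?tv (copy \<phi> * noise (exp (- t)) * K) \<le> ?tv (copy \<phi> * noise (exp (- t)))"
              by (rule total_variation_mult_stochastic)
            also have "\<dots> \<le> d"
              using d[of "\<eta>1 \<circ> \<phi>" "\<eta>2 \<circ> \<phi>"] by (simp add: total_variation_def entry_copy_mult)
            finally show "?tv (copy \<phi> * noise (exp (- t)) * K) \<le> d" .
          qed
        qed (rule convex_total_variation_rows)
        finally show ?case by simp
      qed
    qed
    moreover have "(\<lambda>n. ?tv (F (t / real n) ^ n)) \<longlonglongrightarrow> ?tv ?P"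
      unfolding total_variation_def by (intro tendsto_intros tendsto_entry lim)
    ultimately show ?thesis
      by (intro tendsto_upperbound) auto
  qed
  then show ?thesis
    by (simp add: nvm_law_def transition_eq_exp[abs_def])
qed

lemma noise_flattens:
  "((\<lambda>t. total_variation (entry (noise (exp (- t))) \<eta>1) (entry (noise (exp (- t))) \<eta>2)) \<longlongrightarrow> 0) at_top"
proof -
  have "((\<lambda>t :: real. exp (- t)) \<longlongrightarrow> 0) at_top"
    by (rule filterlim_compose[OF exp_at_bot filterlim_uminus_at_bot_at_top])
  then have "((\<lambda>t. entry (noise (exp (- t))) \<eta> \<zeta>) \<longlongrightarrow> (\<Prod>x\<in>(UNIV :: 'a set). (1 + 0 * spin (\<eta> x) * spin (\<zeta> x)) / 2)) at_top"
    for \<eta> \<zeta> :: "'a \<Rightarrow> bool"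
    unfolding noise_def noise_bit_def entry_Kernel by (intro tendsto_intros) auto
  then have lim: "((\<lambda>t. entry (noise (exp (- t))) \<eta> \<zeta>) \<longlongrightarrow> (\<Prod>x\<in>(UNIV :: 'a set). 1 / 2)) at_top"
    for \<eta> \<zeta> :: "'a \<Rightarrow> bool"
    by simp
  let ?u = "\<lambda>_ :: 'a \<Rightarrow> bool. \<Prod>x\<in>(UNIV :: 'a set). 1 / 2 :: real"
  have "((\<lambda>t. total_variation (entry (noise (exp (- t))) \<eta>1) (entry (noise (exp (- t))) \<eta>2))
      \<longlongrightarrow> total_variation ?u ?u) at_top"
    unfolding total_variation_def by (intro tendsto_intros lim)
  then show ?thesis by (simp add: total_variation_def)
qed

text \<open>The comparison with the hypercube walk at a large time \<open>t\<close> shows that the noisy voter model forgets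
  its initial law.\<close>

lemma nvm_stationary_distribution_unique:
  fixes q :: "'a::finite \<Rightarrow> 'a \<Rightarrow> real"
  assumes q: "\<And>x y. x \<noteq> y \<Longrightarrow> 0 \<le> q x y"
    and \<mu>: "\<mu> \<in> stationary_distributions (nvm_rate q)" and \<nu>: "\<nu> \<in> stationary_distributions (nvm_rate q)"
  shows "\<mu> = \<nu>"
proof (rule total_variation_zero_imp_eq)
  let ?D = "\<lambda>t \<eta>1 \<eta>2. total_variation (entry (noise (exp (- t))) \<eta>1) (entry (noise (exp (- t))) (\<eta>2 :: 'a \<Rightarrow> bool))"
  have le: "total_variation \<mu> \<nu> \<le> (\<Sum>\<eta>1\<in>UNIV. \<Sum>\<eta>2\<in>UNIV. ?D t \<eta>1 \<eta>2)" if t: "0 \<le> t" for t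
  proof -
    have d: "?D t \<eta>1 \<eta>2 \<le> (\<Sum>\<eta>1\<in>UNIV. \<Sum>\<eta>2\<in>UNIV. ?D t \<eta>1 \<eta>2)" for \<eta>1 \<eta>2
    proof -
      have "?D t \<eta>1 \<eta>2 \<le> (\<Sum>\<eta>2\<in>UNIV. ?D t \<eta>1 \<eta>2)"
        by (rule member_le_sum) (auto simp: total_variation_nonneg)
      also have "\<dots> \<le> (\<Sum>\<eta>1\<in>UNIV. \<Sum>\<eta>2\<in>UNIV. ?D t \<eta>1 \<eta>2)"
        by (rule member_le_sum) (auto simp: total_variation_nonneg sum_nonneg)
      finally show ?thesis .
    qed
    let ?P = "exp (t *\<^sub>R gen (nvm_rate q))"
    have "total_variation (\<lambda>\<zeta>. \<Sum>\<eta>\<in>UNIV. \<mu> \<eta> * entry ?P \<eta> \<zeta>) (\<lambda>\<zeta>. \<Sum>\<eta>\<in>UNIV. \<nu> \<eta> * entry ?P \<eta> \<zeta>)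
        \<le> (\<Sum>\<eta>1\<in>UNIV. \<Sum>\<eta>2\<in>UNIV. ?D t \<eta>1 \<eta>2)"
    proof (rule total_variation_mixture_le)
      show "total_variation (entry ?P \<eta>1) (entry ?P \<eta>2) \<le> (\<Sum>\<eta>1\<in>UNIV. \<Sum>\<eta>2\<in>UNIV. ?D t \<eta>1 \<eta>2)" for \<eta>1 \<eta>2
        using total_variation_nvm_le_noise[OF q t d, where ?\<eta>1.0 = \<eta>1 and ?\<eta>2.0 = \<eta>2]
        by (simp add: nvm_law_def transition_eq_exp[abs_def])
    qed (use \<mu> \<nu> in \<open>auto simp: stationary_distributions_def\<close>)
    then show ?thesis
      using \<mu> \<nu> t by (simp add: stationary_distributions_def transition_eq_exp)
  qed
  have "((\<lambda>t. \<Sum>\<eta>1\<in>UNIV. \<Sum>\<eta>2\<in>UNIV. ?D t \<eta>1 \<eta>2) \<longlongrightarrow> (\<Sum>\<eta>1\<in>(UNIV :: ('a \<Rightarrow> bool) set). \<Sum>\<eta>2\<in>(UNIV :: ('a \<Rightarrow> bool) set). 0)) at_top"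
    by (intro tendsto_sum noise_flattens)
  then show "total_variation \<mu> \<nu> \<le> 0"
    using le by (intro tendsto_lowerbound[where F = at_top]) (auto intro: eventually_at_top_linorderI[of 0])
qed

lemma nvm_stationary_is_stationary:
  assumes q: "\<And>x y. x \<noteq> y \<Longrightarrow> 0 \<le> q x y"
  shows "nvm_stationary q \<in> stationary_distributions (nvm_rate q)"
proof -
  obtain \<mu> where "\<mu> \<in> stationary_distributions (nvm_rate q)"
    using stationary_distribution_exists[of "nvm_rate q"] nvm_rate_nonneg[of q, OF q] by blast
  then show ?thesis
    unfolding nvm_stationary_def
    by (intro theI[of "\<lambda>\<mu>. \<mu> \<in> stationary_distributions (nvm_rate q)" \<mu>]
        nvm_stationary_distribution_unique[of q, OF q])
qed

section \<open>Moments of the weighted spin and the lower bound\<close>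

definition weighted_spin :: "('a::finite \<Rightarrow> real) \<Rightarrow> ('a \<Rightarrow> bool) \<Rightarrow> real" where
  "weighted_spin \<pi> \<eta> = (\<Sum>x\<in>UNIV. \<pi> x * spin (\<eta> x))"

lemma weighted_spin_flip:
  "weighted_spin \<pi> (\<eta>(x := \<not> \<eta> x)) = weighted_spin \<pi> \<eta> - 2 * \<pi> x * spin (\<eta> x)"
  unfolding weighted_spin_def by (subst (1 2) sum.remove[of _ x]) auto

text \<open>The drift of the spin at \<open>x\<close>, up to sign: towards 0 by rerandomization, and along the voting chain
  by imitation.\<close>

lemma flip_rate_drift:
  "flip_rate q \<eta> x * (2 * spin (\<eta> x)) = spin (\<eta> x) - act (gen q) (\<lambda>y. spin (\<eta> y)) x"
proof -
  have "act (gen q) (\<lambda>y. spin (\<eta> y)) x = (\<Sum>y\<in>UNIV - {x}. q x y * (spin (\<eta> y) - spin (\<eta> x)))"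
    unfolding act_gen by (subst sum.remove[of _ x]) auto
  also have "\<dots> = - (\<Sum>y\<in>UNIV - {x}. q x y * (if \<eta> x then 1 - of_bool (\<eta> y) else of_bool (\<eta> y))) * (2 * spin (\<eta> x))"
    unfolding sum_distrib_right sum_negf[symmetric]
    by (intro sum.cong refl) (auto simp: spin_def)
  finally show ?thesis
    by (cases "\<eta> x") (simp_all add: flip_rate_def distrib_right)
qed

text \<open>Summed over the sites with weights \<open>\<pi>\<close>, the voting part of the drift cancels by stationarity.\<close>

lemma act_weighted_spin:
  assumes \<pi>: "\<pi> \<in> stationary_distributions q"
  shows "act (gen (nvm_rate q)) (weighted_spin \<pi>) \<eta> = - weighted_spin \<pi> \<eta>"
proof -
  have "(\<Sum>x\<in>UNIV. \<pi> x * act (gen q) f x) = (\<Sum>y\<in>UNIV. (\<Sum>x\<in>UNIV. \<pi> x * entry (gen q) x y) * f y)" for f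
    unfolding act_def sum_distrib_left sum_distrib_right by (subst sum.swap) (simp add: mult.assoc)
  then have balance: "(\<Sum>x\<in>UNIV. \<pi> x * act (gen q) f x) = 0" for f
    by (simp add: stationary_left_null[OF \<pi>])
  have "flip_rate q \<eta> x * (weighted_spin \<pi> (\<eta>(x := \<not> \<eta> x)) - weighted_spin \<pi> \<eta>)
      = \<pi> x * act (gen q) (\<lambda>y. spin (\<eta> y)) x - \<pi> x * spin (\<eta> x)" for x
  proof -
    have "flip_rate q \<eta> x * (weighted_spin \<pi> (\<eta>(x := \<not> \<eta> x)) - weighted_spin \<pi> \<eta>)
        = - \<pi> x * (flip_rate q \<eta> x * (2 * spin (\<eta> x)))"
      by (simp add: weighted_spin_flip)
    then show ?thesis unfolding flip_rate_drift by (simp add: algebra_simps)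
  qed
  then show ?thesis
    by (simp add: act_gen_nvm sum_subtractf balance weighted_spin_def)
qed

text \<open>An upper bound for the variance of \<open>weighted_spin \<pi>\<close> started from a fixed configuration. Each flip contributes its rate, at most \<open>1 / 2 + q_max q\<close>, times the
  squared jump \<open>4 (\<pi> x)\<^sup>2\<close>, and the eigenvalue \<open>-1\<close> makes the square decay at rate 2.\<close>

definition spin_variance :: "('a::finite \<Rightarrow> 'a \<Rightarrow> real) \<Rightarrow> ('a \<Rightarrow> real) \<Rightarrow> real" where
  "spin_variance q \<pi> = (1 + 2 * q_max q) * (\<Sum>x\<in>UNIV. (\<pi> x)\<^sup>2)"

lemma flip_rate_le:
  assumes q: "\<And>x y. x \<noteq> y \<Longrightarrow> 0 \<le> q x y"
  shows "flip_rate q \<eta> x \<le> 1 / 2 + q_max q"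
proof -
  have le: "(\<Sum>y\<in>UNIV - {x}. q x y * b y) \<le> q_max q" if "\<And>y. b y \<le> 1" for b :: "'a \<Rightarrow> real"
  proof -
    have "(\<Sum>y\<in>UNIV - {x}. q x y * b y) \<le> (\<Sum>y\<in>UNIV - {x}. q x y)"
    proof (rule sum_mono)
      fix y assume "y \<in> UNIV - {x}"
      then have "0 \<le> q x y" using q[of x y] by blast
      from mult_left_mono[OF that this] show "q x y * b y \<le> q x y" by simp
    qed
    also have "\<dots> \<le> q_max q"
      unfolding q_max_def by (rule Max_ge) auto
    finally show ?thesis .
  qed
  show ?thesis
    using le[of "\<lambda>y. 1 - of_bool (\<eta> y)"] le[of "\<lambda>y. of_bool (\<eta> y)"] by (simp add: flip_rate_def)
qed

lemma act_weighted_spin_square: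
  assumes q: "\<And>x y. x \<noteq> y \<Longrightarrow> 0 \<le> q x y" and \<pi>: "\<pi> \<in> stationary_distributions q"
  shows "act (gen (nvm_rate q)) (\<lambda>\<eta>. (weighted_spin \<pi> \<eta>)\<^sup>2) \<eta>
    \<le> 2 * spin_variance q \<pi> - 2 * (weighted_spin \<pi> \<eta>)\<^sup>2"
proof -
  let ?W = "weighted_spin \<pi>"
  have "(?W (\<eta>(x := \<not> \<eta> x)))\<^sup>2 - (?W \<eta>)\<^sup>2
      = 2 * ?W \<eta> * (?W (\<eta>(x := \<not> \<eta> x)) - ?W \<eta>) + 4 * (\<pi> x)\<^sup>2" for x
  proof -
    have "(2 * \<pi> x * spin (\<eta> x))\<^sup>2 = 4 * (\<pi> x)\<^sup>2"
      by (simp add: power_mult_distrib power2_eq_square[of "spin _"])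
    then show ?thesis
      unfolding weighted_spin_flip by (simp add: power2_diff algebra_simps)
  qed
  then have "act (gen (nvm_rate q)) (\<lambda>\<eta>. (?W \<eta>)\<^sup>2) \<eta>
      = 2 * ?W \<eta> * act (gen (nvm_rate q)) ?W \<eta> + (\<Sum>x\<in>UNIV. flip_rate q \<eta> x * (4 * (\<pi> x)\<^sup>2))"
    by (simp add: act_gen_nvm distrib_left sum.distrib sum_distrib_left mult_ac)
  also have "\<dots> = - 2 * (?W \<eta>)\<^sup>2 + (\<Sum>x\<in>UNIV. flip_rate q \<eta> x * (4 * (\<pi> x)\<^sup>2))"
    by (simp add: act_weighted_spin[OF \<pi>] power2_eq_square)
  also have "(\<Sum>x\<in>UNIV. flip_rate q \<eta> x * (4 * (\<pi> x)\<^sup>2)) \<le> (\<Sum>x\<in>UNIV. (1 / 2 + q_max q) * (4 * (\<pi> x)\<^sup>2))"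
    by (intro sum_mono mult_right_mono flip_rate_le q) auto
  also have "\<dots> = 2 * spin_variance q \<pi>"
    by (simp add: spin_variance_def sum_distrib_left algebra_simps sum.distrib)
  finally show ?thesis by simp
qed

text \<open>With \<open>W\<close> the weighted spin and \<open>V\<close> its variance bound, the function \<open>f = V - W\<^sup>2\<close> satisfies \<open>G f \<ge> - 2 f\<close>, so \<open>act_exp_mono\<close> applies.\<close>

lemma second_moment_bound:
  assumes q: "\<And>x y. x \<noteq> y \<Longrightarrow> 0 \<le> q x y" and \<pi>: "\<pi> \<in> stationary_distributions q" and t: "0 \<le> t"
  shows "(\<Sum>\<zeta>\<in>UNIV. nvm_law q \<eta> t \<zeta> * (weighted_spin \<pi> \<zeta>)\<^sup>2)
    \<le> exp (- 2 * t) * (weighted_spin \<pi> \<eta>)\<^sup>2 + (1 - exp (- 2 * t)) * spin_variance q \<pi>"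
proof -
  let ?W = "weighted_spin \<pi>" and ?V = "spin_variance q \<pi>" and ?P = "exp (t *\<^sub>R gen (nvm_rate q))"
  have P: "stochastic (exp (s *\<^sub>R gen (nvm_rate q)))" if "0 \<le> s" for s
    using that by (intro stochastic_exp_nvm q)
  have split: "act A (\<lambda>\<zeta>. ?V + (- 1) * (?W \<zeta>)\<^sup>2) \<eta> = act A (\<lambda>_. ?V) \<eta> - act A (\<lambda>\<zeta>. (?W \<zeta>)\<^sup>2) \<eta>" for A \<eta>
    unfolding act_fun_add act_fun_cmult by simp
  have "exp (- 2 * t) * (?V + (- 1) * (?W \<eta>)\<^sup>2) \<le> act ?P (\<lambda>\<zeta>. ?V + (- 1) * (?W \<zeta>)\<^sup>2) \<eta>"
  proof (rule act_exp_mono[OF _ _ t])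
    show "- 2 * (?V + (- 1) * (?W \<zeta>)\<^sup>2) \<le> act (gen (nvm_rate q)) (\<lambda>\<zeta>. ?V + (- 1) * (?W \<zeta>)\<^sup>2) \<zeta>" for \<zeta>
      using act_weighted_spin_square[OF q \<pi>, of \<zeta>] unfolding split by (simp add: act_gen)
  qed (use P in \<open>simp add: stochastic_nonneg\<close>)
  also have "\<dots> = ?V - act ?P (\<lambda>\<zeta>. (?W \<zeta>)\<^sup>2) \<eta>"
    unfolding split by (simp add: act_def stochastic_row_sum[OF P[OF t]] flip: sum_distrib_right)
  finally show ?thesis
    by (simp add: act_def nvm_law_def transition_eq_exp algebra_simps)
qed

lemma mean_weighted_spin:
  assumes \<pi>: "\<pi> \<in> stationary_distributions q"
  shows "(\<Sum>\<zeta>\<in>UNIV. nvm_law q \<eta> t \<zeta> * weighted_spin \<pi> \<zeta>) = exp (- t) * weighted_spin \<pi> \<eta>"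
  using act_exp_eigen[of "gen (nvm_rate q)" "weighted_spin \<pi>" "- 1" t \<eta>] act_weighted_spin[OF \<pi>]
  by (simp add: act_def nvm_law_def transition_eq_exp)

lemma stationary_expectation:
  assumes "\<mu> \<in> stationary_distributions (nvm_rate q)" "0 \<le> t"
  shows "(\<Sum>\<zeta>\<in>UNIV. \<mu> \<zeta> * f \<zeta>) = (\<Sum>\<eta>\<in>UNIV. \<mu> \<eta> * (\<Sum>\<zeta>\<in>UNIV. nvm_law q \<eta> t \<zeta> * f \<zeta>))"
proof -
  have "(\<Sum>\<zeta>\<in>UNIV. \<mu> \<zeta> * f \<zeta>) = (\<Sum>\<zeta>\<in>UNIV. (\<Sum>\<eta>\<in>UNIV. \<mu> \<eta> * nvm_law q \<eta> t \<zeta>) * f \<zeta>)"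
    using assms by (simp add: stationary_distributions_def nvm_law_def)
  also have "\<dots> = (\<Sum>\<eta>\<in>UNIV. \<mu> \<eta> * (\<Sum>\<zeta>\<in>UNIV. nvm_law q \<eta> t \<zeta> * f \<zeta>))"
    unfolding sum_distrib_left sum_distrib_right by (subst sum.swap) (simp add: mult.assoc)
  finally show ?thesis .
qed

text \<open>In equilibrium, the moments are unchanged by running the chain for time 1, while that step
  contracts the mean by \<open>exp (- 1)\<close> and moves the second moment towards its bound.\<close>

lemma stationary_moments:
  assumes q: "\<And>x y. x \<noteq> y \<Longrightarrow> 0 \<le> q x y" and \<pi>: "\<pi> \<in> stationary_distributions q"
    and \<mu>: "\<mu> \<in> stationary_distributions (nvm_rate q)"
  shows "(\<Sum>\<zeta>\<in>UNIV. \<mu> \<zeta> * weighted_spin \<pi> \<zeta>) = 0"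
    and "(\<Sum>\<zeta>\<in>UNIV. \<mu> \<zeta> * (weighted_spin \<pi> \<zeta>)\<^sup>2) \<le> spin_variance q \<pi>"
proof -
  let ?W = "weighted_spin \<pi>" and ?V = "spin_variance q \<pi>"
  have prob: "\<And>\<eta>. 0 \<le> \<mu> \<eta>" "(\<Sum>\<eta>\<in>UNIV. \<mu> \<eta>) = 1"
    using \<mu> by (auto simp: stationary_distributions_def)
  have "(\<Sum>\<zeta>\<in>UNIV. \<mu> \<zeta> * ?W \<zeta>) = (\<Sum>\<eta>\<in>UNIV. \<mu> \<eta> * (exp (- 1) * ?W \<eta>))"
    unfolding stationary_expectation[OF \<mu> zero_le_one, of ?W] mean_weighted_spin[OF \<pi>] ..
  also have "\<dots> = exp (- 1) * (\<Sum>\<zeta>\<in>UNIV. \<mu> \<zeta> * ?W \<zeta>)"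
    by (simp add: sum_distrib_left mult_ac)
  finally show "(\<Sum>\<zeta>\<in>UNIV. \<mu> \<zeta> * ?W \<zeta>) = 0" by simp
  let ?m = "\<Sum>\<zeta>\<in>UNIV. \<mu> \<zeta> * (?W \<zeta>)\<^sup>2"
  have "?m \<le> (\<Sum>\<eta>\<in>UNIV. \<mu> \<eta> * (exp (- 2 * 1) * (?W \<eta>)\<^sup>2 + (1 - exp (- 2 * 1)) * ?V))"
    unfolding stationary_expectation[OF \<mu> zero_le_one, of "\<lambda>\<zeta>. (?W \<zeta>)\<^sup>2"]
    by (intro sum_mono mult_left_mono second_moment_bound q \<pi> prob zero_le_one)
  also have "\<dots> = exp (- 2 * 1) * ?m + (1 - exp (- 2 * 1)) * ?V * (\<Sum>\<eta>\<in>UNIV. \<mu> \<eta>)"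
    by (simp add: distrib_left sum.distrib sum_distrib_left sum_distrib_right mult_ac)
  finally have "(1 - exp (- 2 * 1)) * ?m \<le> (1 - exp (- 2 * 1)) * ?V"
    by (simp add: prob algebra_simps)
  then show "?m \<le> ?V" by simp
qed

text \<open>Since \<open>\<pi>\<close> has total mass 1, its minimum is at most \<open>1 / |S|\<close> and its maximum at most \<open>r / |S|\<close>; hence
  \<open>\<Sum>\<pi>\<^sup>2 \<le> max \<pi> \<le> r / |S|\<close>, and \<open>r \<le> r\<^sup>2\<close> as \<open>r \<ge> 1\<close>.\<close>

lemma spin_variance_le:
  fixes q :: "'a::finite \<Rightarrow> 'a \<Rightarrow> real"
  assumes q: "\<And>x y. x \<noteq> y \<Longrightarrow> 0 \<le> q x y"
    and \<pi>: "\<And>x. 0 \<le> \<pi> x" "(\<Sum>x\<in>UNIV. \<pi> x) = 1" and r: "rho_dist \<pi> \<le> ereal r"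
  shows "real CARD('a) * spin_variance q \<pi> \<le> (1 + q_max q)\<^sup>2 * r\<^sup>2"
proof -
  let ?M = "MAX x\<in>UNIV. \<pi> x" and ?m = "MIN x\<in>UNIV. \<pi> x"
  have M: "\<pi> x \<le> ?M" and m: "?m \<le> \<pi> x" for x by auto
  have m_pos: "0 < ?m"
  proof -
    have "0 \<le> ?m" by (rule Min.boundedI) (auto simp: \<pi>)
    moreover have "?m \<noteq> 0" using r by (auto simp: rho_dist_def)
    ultimately show ?thesis by linarith
  qed
  then have "?m \<noteq> 0" by linarith
  then have "rho_dist \<pi> = ereal (?M / ?m)"
    unfolding rho_dist_def by (rule if_not_P)
  with r have Mr: "?M / ?m \<le> r" by (simp only: ereal_less_eq)
  have r1: "1 \<le> r"
    using M[of undefined] m[of undefined] m_pos by (intro order_trans[OF _ Mr]) (simp add: le_divide_eq)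
  have qm: "0 \<le> q_max q"
  proof -
    have "0 \<le> (\<Sum>y\<in>UNIV - {undefined}. q undefined y)"
    proof (rule sum_nonneg)
      fix y assume "y \<in> UNIV - {undefined :: 'a}"
      then show "0 \<le> q undefined y" using q[of undefined y] by blast
    qed
    also have "\<dots> \<le> q_max q" unfolding q_max_def by (rule Max_ge) auto
    finally show ?thesis .
  qed
  have "(\<Sum>x\<in>UNIV. (\<pi> x)\<^sup>2) \<le> (\<Sum>x\<in>UNIV. ?M * \<pi> x)"
    unfolding power2_eq_square by (intro sum_mono mult_right_mono M \<pi>)
  also have "\<dots> = ?M" by (simp add: \<pi> flip: sum_distrib_left)
  also have "\<dots> \<le> r * ?m" using Mr m_pos by (simp add: divide_le_eq)
  finally have "real CARD('a) * (\<Sum>x\<in>UNIV. (\<pi> x)\<^sup>2) \<le> real CARD('a) * (r * ?m)"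
    by (intro mult_left_mono) auto
  also have "\<dots> = r * (\<Sum>x\<in>(UNIV :: 'a set). ?m)" by simp
  also have "\<dots> \<le> r * (\<Sum>x\<in>UNIV. \<pi> x)"
    using r1 m by (intro mult_left_mono sum_mono) auto
  also have "\<dots> = r" by (simp add: \<pi>)
  also have "r \<le> r\<^sup>2" using r1 by (simp add: power2_eq_square)
  finally have "(1 + 2 * q_max q) * (real CARD('a) * (\<Sum>x\<in>UNIV. (\<pi> x)\<^sup>2)) \<le> (1 + q_max q)\<^sup>2 * r\<^sup>2"
    using qm by (intro mult_mono) (auto simp: power2_eq_square algebra_simps intro!: sum_nonneg mult_nonneg_nonneg \<pi>)
  then show ?thesis by (simp add: spin_variance_def mult_ac)
qed

lemma rho_dist_ge_one:
  assumes \<pi>: "\<And>x. 0 \<le> \<pi> x" shows "1 \<le> rho_dist \<pi>"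
proof -
  let ?M = "MAX x\<in>UNIV. \<pi> x" and ?m = "MIN x\<in>UNIV. \<pi> x"
  have "0 \<le> ?m" by (rule Min.boundedI) (auto simp: \<pi>)
  have "?m \<le> \<pi> undefined" "\<pi> undefined \<le> ?M" by auto
  then have "?m \<le> ?M" by (rule order_trans)
  show ?thesis
  proof (cases "?m = 0")
    case True
    then show ?thesis unfolding rho_dist_def by (subst if_P) auto
  next
    case False
    with \<open>0 \<le> ?m\<close> have "0 < ?m" by linarith
    with \<open>?m \<le> ?M\<close> have "1 \<le> ?M / ?m" by (subst le_divide_eq_1_pos)
    then show ?thesis
      unfolding rho_dist_def using False by (subst if_not_P) (auto simp: one_ereal_def)
  qed
qed

lemma total_variation_nvm_lower_bound:
  fixes q :: "'a::finite \<Rightarrow> 'a \<Rightarrow> real"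
  assumes q: "\<And>x y. x \<noteq> y \<Longrightarrow> 0 \<le> q x y" and \<pi>: "\<pi> \<in> stationary_distributions q"
    and r: "rho_dist \<pi> \<le> ereal r" and t: "0 \<le> t" "t = 1 / 2 * ln (real CARD('a)) - \<alpha>"
  shows "exp (2 * \<alpha>) \<le> total_variation (nvm_law q (\<lambda>_. True) t) (nvm_stationary q)
    * (exp (2 * \<alpha>) + 4 * (1 + q_max q)\<^sup>2 * r\<^sup>2)"
proof -
  let ?V = "spin_variance q \<pi>" and ?n = "real CARD('a)"
  let ?tv = "total_variation (nvm_law q (\<lambda>_. True) t) (nvm_stationary q)"
  have prob: "\<And>x. 0 \<le> \<pi> x" "(\<Sum>x\<in>UNIV. \<pi> x) = 1"
    using \<pi> by (auto simp: stationary_distributions_def)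
  have W1: "weighted_spin \<pi> (\<lambda>_. True) = 1" by (simp add: weighted_spin_def prob)
  have P: "stochastic (exp (t *\<^sub>R gen (nvm_rate q)))"
    using t by (intro stochastic_exp_nvm q)
  note \<mu> = nvm_stationary_is_stationary[of q, OF q]
  have "0 \<le> (\<Sum>\<zeta>\<in>UNIV. nvm_stationary q \<zeta> * (weighted_spin \<pi> \<zeta>)\<^sup>2)"
    using \<mu> by (intro sum_nonneg) (auto simp: stationary_distributions_def)
  with stationary_moments(2)[OF q \<pi> \<mu>] have V: "0 \<le> ?V" by simp
  have sq: "(exp (- t))\<^sup>2 = exp (- 2 * t)"
    by (simp add: power2_eq_square flip: exp_add)
  have "(exp (- t))\<^sup>2 \<le> ?tv * ((exp (- t))\<^sup>2 + 4 * ?V)"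
  proof (rule total_variation_lower_bound)
    show "(\<Sum>\<zeta>\<in>UNIV. nvm_law q (\<lambda>_. True) t \<zeta> * weighted_spin \<pi> \<zeta>) = exp (- t)"
      by (simp add: mean_weighted_spin[OF \<pi>] W1)
    have "(\<Sum>\<zeta>\<in>UNIV. nvm_law q (\<lambda>_. True) t \<zeta> * (weighted_spin \<pi> \<zeta>)\<^sup>2)
        \<le> exp (- 2 * t) + (1 - exp (- 2 * t)) * ?V"
      using second_moment_bound[OF q \<pi> t(1), of "\<lambda>_. True"] by (simp add: W1)
    also have "\<dots> \<le> exp (- 2 * t) + 1 * ?V"
      using V by (intro add_left_mono mult_right_mono) auto
    finally show "(\<Sum>\<zeta>\<in>UNIV. nvm_law q (\<lambda>_. True) t \<zeta> * (weighted_spin \<pi> \<zeta>)\<^sup>2) \<le> (exp (- t))\<^sup>2 + ?V"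
      by (simp add: sq)
  qed (use \<mu> P stationary_moments[OF q \<pi> \<mu>] in
      \<open>auto simp: stationary_distributions_def nvm_law_def transition_eq_exp stochastic_def\<close>)
  then have "?n * (exp (- t))\<^sup>2 \<le> ?n * (?tv * ((exp (- t))\<^sup>2 + 4 * ?V))"
    by (intro mult_left_mono) auto
  also have "?n * (?tv * ((exp (- t))\<^sup>2 + 4 * ?V)) = ?tv * (?n * (exp (- t))\<^sup>2 + 4 * (?n * ?V))"
    by (simp add: algebra_simps)
  also have "?n * (exp (- t))\<^sup>2 = exp (2 * \<alpha>)"
  proof -
    have "- 2 * t = 2 * \<alpha> - ln ?n" by (simp add: t(2))
    then show ?thesis unfolding sq by (simp add: exp_diff)
  qed
  also have "?tv * (exp (2 * \<alpha>) + 4 * (?n * ?V)) \<le> ?tv * (exp (2 * \<alpha>) + 4 * ((1 + q_max q)\<^sup>2 * r\<^sup>2))"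
    by (intro mult_left_mono add_left_mono spin_variance_le q prob r total_variation_nonneg) auto
  finally show ?thesis by (simp add: mult.assoc)
qed

theorem theorem3:
  fixes q :: "'a::finite \<Rightarrow> 'a \<Rightarrow> real"
  assumes "CARD('a) \<ge> 2"
    and "\<And>x y. x \<noteq> y \<Longrightarrow> 0 \<le> q x y"
  shows "(\<forall>\<alpha> t :: real. \<alpha> \<ge> 1 \<longrightarrow> t = 1 / 2 * ln (real CARD('a)) - \<alpha> \<longrightarrow> t \<ge> 1 \<longrightarrow>
            total_variation (nvm_law q (\<lambda>_. True) t) (nvm_stationary q) \<ge>
              (if rho q = \<infinity> then 0
               else 0.7 * exp (2 * \<alpha>) /
                 (16 * (1 + q_max q)\<^sup>2 * (real_of_ereal (rho q))\<^sup>2 + 0.7 * exp (2 * \<alpha>)))) \<and>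
         (\<forall>t :: real. t \<ge> 0 \<longrightarrow>
            (MAX (\<eta>1, \<eta>2) \<in> (UNIV :: (('a \<Rightarrow> bool) \<times> ('a \<Rightarrow> bool)) set). total_variation (nvm_law q \<eta>1 t) (nvm_law q \<eta>2 t))
            \<le> (MAX (\<eta>1, \<eta>2) \<in> (UNIV :: (('a \<Rightarrow> bool) \<times> ('a \<Rightarrow> bool)) set).
                 total_variation (nvm_law (\<lambda>_ _. 0) \<eta>1 t) (nvm_law (\<lambda>_ _. 0) \<eta>2 t)))"
proof (intro conjI allI impI)
  fix \<alpha> t :: real
  assume t: "t = 1 / 2 * ln (real CARD('a)) - \<alpha>" "1 \<le> t"
  let ?tv = "total_variation (nvm_law q (\<lambda>_. True) t) (nvm_stationary q)"
  show "?tv \<ge> (if rho q = \<infinity> then 0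
      else 0.7 * exp (2 * \<alpha>) /
        (16 * (1 + q_max q)\<^sup>2 * (real_of_ereal (rho q))\<^sup>2 + 0.7 * exp (2 * \<alpha>)))"
  proof (cases "rho q = \<infinity>")
    case False
    have "1 \<le> rho q"
      unfolding rho_def by (intro INF_greatest rho_dist_ge_one) (simp add: stationary_distributions_def)
    with False obtain R where R: "rho q = ereal R" "1 \<le> R"
      by (cases "rho q") (auto simp: one_ereal_def)
    \<comment> \<open>Giving away a factor 2 in \<open>\<rho>\<close> turns the constant 4 of the second moment bound into 16.\<close>
    then have "rho q < ereal (2 * R)" by simp
    then obtain \<pi> where \<pi>: "\<pi> \<in> stationary_distributions q" "rho_dist \<pi> < ereal (2 * R)"
      unfolding rho_def INF_less_iff by blast
    define E where "E = exp (2 * \<alpha>)"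
    define B where "B = 16 * (1 + q_max q)\<^sup>2 * R\<^sup>2"
    have E: "0 < E" and B: "0 \<le> B" by (auto simp: E_def B_def)
    have "E \<le> ?tv * (E + 4 * (1 + q_max q)\<^sup>2 * (2 * R)\<^sup>2)"
      unfolding E_def using t \<pi>
      by (intro total_variation_nvm_lower_bound assms(2)) auto
    then have "E / (E + B) \<le> ?tv"
      using E B by (simp add: divide_le_eq add_pos_nonneg B_def power_mult_distrib mult_ac)
    moreover have "0.7 * E / (B + 0.7 * E) \<le> E / (E + B)"
      using E B by (simp add: divide_simps add_pos_nonneg add_nonneg_pos)
    ultimately show ?thesis
      using False by (simp add: R E_def B_def)
  qed (simp add: total_variation_nonneg)
next
  fix t :: real
  assume t: "0 \<le> t"
  let ?H = "\<lambda>(\<eta>1, \<eta>2). total_variation (nvm_law (\<lambda>_ _. 0) \<eta>1 t) (nvm_law (\<lambda>_ _. 0) (\<eta>2 :: 'a \<Rightarrow> bool) t)"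
  have law: "nvm_law (\<lambda>_ _. 0) \<eta> t = entry (noise (exp (- t))) (\<eta> :: 'a \<Rightarrow> bool)" for \<eta>
    by (simp add: nvm_law_def transition_eq_exp[abs_def] exp_noise_generator[OF t])
  have d: "total_variation (entry (noise (exp (- t))) \<eta>1) (entry (noise (exp (- t))) \<eta>2) \<le> Max (range ?H)"
    for \<eta>1 \<eta>2 :: "'a \<Rightarrow> bool"
    unfolding law[symmetric] by (rule Max_ge) (auto intro: image_eqI[of _ _ "(\<eta>1, \<eta>2)"])
  show "(MAX (\<eta>1, \<eta>2)\<in>UNIV. total_variation (nvm_law q \<eta>1 t) (nvm_law q \<eta>2 t)) \<le> Max (range ?H)"
    by (rule Max.boundedI) (auto intro!: total_variation_nvm_le_noise[OF assms(2) t d])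
qed

end
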